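(* Let $n\ge 3$ and let $M$ be an $n$-dimensional $C$-totally real submanifold of a $(2m+1)$-dimensional generalized $(\kappa,\mu)$-contact space form with divided $R_5$, $\tilde M(f_1,f_2,f_3,f_4,f_{5,1},f_{5,2},f_6)$. Then for each point $p\in M$: (1) For every unit vector $U\in T_pM$, $$\begin{aligned}\operatorname{Ric}(U)\le{}&\tfrac14n^2\|H\|^2+(n-1)f_1+f_4\big(\operatorname{trace}(h^T)+(n-2)\langle h^TU,U\rangle\big)\\&+f_{5,1}\big(\operatorname{trace}(h^T)\langle h^TU,U\rangle-\|h^TU\|^2\big)\\&+f_{5,2}\big(\operatorname{trace}((\phi h)^T)\langle(\phi h)^TU,U\rangle-\|(\phi h)^TU\|^2\big).\end{aligned}$$ (2) If $H(p)=0$, then a unit tangent vector $U\in T_pM$ satisfies equality in the inequality of (1) if and only if $U$ belongs to the relative null space $\mathcal N_p$. (3) Equality in the inequality of (1) holds for all unit tangent vectors at $p$ if and only if either $p$ is a totally geodesic point or $n=2$ and $p$ is a totally umbilical point.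
   Context: An almost contact metric manifold $(\tilde M,\phi,\xi,\eta,\langle,\rangle)$ is a manifold with a $(1,1)$-tensor field $\phi$, a vector field $\xi$, a 1-form $\eta$ and a Riemannian metric $\langle,\rangle$ satisfying $\phi^2=-I+\eta\otimes\xi$, $\eta(\xi)=1$, $\eta\circ\phi=0$, $\phi\xi=0$, $\langle X,Y\rangle=\langle\phi X,\phi Y\rangle+\eta(X)\eta(Y)$, $\langle X,\xi\rangle=\eta(X)$, $\langle X,\phi Y\rangle=-\langle\phi X,Y\rangle$. It is a contact metric manifold if $d\eta(X,Y)=\langle X,\phi Y\rangle$. Put $2h=\mathcal L_\xi\phi$ (Lie derivative). On a contact metric manifold $h$ is symmetric, $h\xi=0$, $h\phi+\phi h=0$, $\operatorname{trace}h=\operatorname{trace}(\phi h)=0$, and $\tilde\nabla_X\xi=-\phi X-\phi hX$ (this fixes the normalization of $d\eta$). A generalized $(\kappa,\mu)$-space form with divided $R_5$, denoted $\tilde M(f_1,f_2,f_3,f_4,f_{5,1},f_{5,2},f_6)$, is an almost contact metric manifold with differentiable functions $f_1,f_2,f_3,f_4,f_{5,1},f_{5,2},f_6$ on $\tilde M$ such that its curvature tensor is $\tilde R=f_1R_1+f_2R_2+f_3R_3+f_4R_4+f_{5,1}R_{5,1}+f_{5,2}R_{5,2}+f_6R_6$, where $R_1(X,Y)Z=\langle Y,Z\rangle X-\langle X,Z\rangle Y$; $R_2(X,Y)Z=\langle X,\phi Z\rangle\phi Y-\langle Y,\phi Z\rangle\phi X+2\langle X,\phi Y\rangle\phi Z$;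 $R_3(X,Y)Z=\eta(X)\eta(Z)Y-\eta(Y)\eta(Z)X+\langle X,Z\rangle\eta(Y)\xi-\langle Y,Z\rangle\eta(X)\xi$; $R_4(X,Y)Z=\langle Y,Z\rangle hX-\langle X,Z\rangle hY+\langle hY,Z\rangle X-\langle hX,Z\rangle Y$; $R_{5,1}(X,Y)Z=\langle hY,Z\rangle hX-\langle hX,Z\rangle hY$; $R_{5,2}(X,Y)Z=\langle\phi hY,Z\rangle\phi hX-\langle\phi hX,Z\rangle\phi hY$; $R_6(X,Y)Z=\eta(X)\eta(Z)hY-\eta(Y)\eta(Z)hX+\langle hX,Z\rangle\eta(Y)\xi-\langle hY,Z\rangle\eta(X)\xi$. It is called a generalized $(\kappa,\mu)$-contact space form with divided $R_5$ when the structure is contact metric. Curvature convention: $\tilde R(X,Y,Z,W)=\langle\tilde R(X,Y)Z,W\rangle$, and the sectional curvature of the plane spanned by orthonormal $X,Y$ is $\tilde R(X,Y,Y,X)$ (similarly for $M$). A submanifold $M$ of a contact metric manifold $\tilde M$ is $C$-totally real if $\xi$ is normal to $M$ (every tangent vector lies in the contact distribution $\ker\eta$). $M$ carries the induced metric; $\sigma$ is its second fundamental form and $H=\frac1n\operatorname{trace}(\sigma)$ the mean curvature vector. The Ricci curvature of $M$ at a unit vector $U\in T_pM$ is $\operatorname{Ric}(U)=\sum_{j=2}^nK(e_1\wedge e_j)$, where $\{e_1=U,e_2,\dots,e_n\}$ is an orthonormal basis of $T_pM$ and $K$ is the sectional curvature of $M$. The relative null space at $p$ is $\mathcal N_p=\{X\in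 T_pM:\sigma(X,Y)=0\ \forall Y\in T_pM\}$. A point $p$ is totally geodesic if $\sigma=0$ at $p$, and totally umbilical if $\sigma(X,Y)=\langle X,Y\rangle H$ for all $X,Y\in T_pM$. For $X$ tangent to $M$, $h^TX$ and $(\phi h)^TX$ are the components tangent to $M$ of $hX$ and $\phi hX$. All quantities in the inequality are evaluated at $p$. *)

theory Defs
  imports "HOL-Analysis.Analysis"
begin

section \<open>Smooth manifolds and tensor fields\<close>

text \<open>For open \<open>S\<close> in finite dimension the following is the usual notion of a
  \<open>C\<^sup>k\<close> map: all iterated directional derivatives up to order \<open>k\<close> exist and are continuous.\<close>

primrec Ck_on :: "nat \<Rightarrow> 'a::real_normed_vector set \<Rightarrow> ('a \<Rightarrow> 'b::real_normed_vector) \<Rightarrow> bool" where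
  "Ck_on 0 S f \<longleftrightarrow> continuous_on S f"
| "Ck_on (Suc k) S f \<longleftrightarrow>
     (\<forall>x\<in>S. f differentiable (at x)) \<and> (\<forall>v. Ck_on k S (\<lambda>x. frechet_derivative f (at x) v))"

definition smooth_on :: "'a::real_normed_vector set \<Rightarrow> ('a \<Rightarrow> 'b::real_normed_vector) \<Rightarrow> bool" where
  "smooth_on S f \<longleftrightarrow> (\<forall>k. Ck_on k S f)"

text \<open>A chart is a pair of its domain and its coordinate map; the latter is only
  meaningful on the domain.\<close>

type_synonym ('a, 'e) chart = "'a set \<times> ('a \<Rightarrow> 'e)"

abbreviation chart_image :: "('a, 'e) chart \<Rightarrow> 'e set" where
  "chart_image \<kappa> \<equiv> snd \<kappa> ` fst \<kappa>"

definition chart_inv :: "('a, 'e) chart \<Rightarrow> 'e \<Rightarrow> 'a" where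
  "chart_inv \<kappa> = inv_into (fst \<kappa>) (snd \<kappa>)"

text \<open>The two charts may belong to different manifolds (with possibly different dimensions)
  sharing points, so that this is also the coordinate expression of an inclusion map.\<close>

definition transition :: "('a, 'd) chart \<Rightarrow> ('a, 'e) chart \<Rightarrow> 'd \<Rightarrow> 'e" where
  "transition \<kappa> \<kappa>' = snd \<kappa>' \<circ> chart_inv \<kappa>"

text \<open>The atlas need not be maximal.\<close>

definition smooth_manifold :: "'a topology \<Rightarrow> ('a, 'e::euclidean_space) chart set \<Rightarrow> bool" where
  "smooth_manifold T A \<longleftrightarrow>
     Hausdorff_space T \<and> second_countable T \<and>
     (\<Union>\<kappa>\<in>A. fst \<kappa>) = topspace T \<and>
     (\<forall>\<kappa>\<in>A. openin T (fst \<kappa>) \<and> open (chart_image \<kappa>) \<and>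
        homeomorphic_map (subtopology T (fst \<kappa>)) (top_of_set (chart_image \<kappa>)) (snd \<kappa>)) \<and>
     (\<forall>\<kappa>\<in>A. \<forall>\<kappa>'\<in>A. smooth_on (snd \<kappa> ` (fst \<kappa> \<inter> fst \<kappa>')) (transition \<kappa> \<kappa>'))"

text \<open>A tensor field is given by its coordinate expressions: one expression for each chart of
  the atlas, depending on the coordinates of the point, subject to the transformation law of
  tensors under the differential \<open>J\<close> of every change of charts.  In the same way, a tangent vector
  at a point is represented by its component vector in a chart around that point.\<close>

type_synonym ('a, 'e) vector_field = "('a, 'e) chart \<Rightarrow> 'e \<Rightarrow> 'e"
type_synonym ('a, 'e) one_form = "('a, 'e) chart \<Rightarrow> 'e \<Rightarrow> 'e \<Rightarrow> real"
type_synonym ('a, 'e) endo_field = "('a, 'e) chart \<Rightarrow> 'e \<Rightarrow> 'e \<Rightarrow> 'e"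
type_synonym ('a, 'e) bilinear_field = "('a, 'e) chart \<Rightarrow> 'e \<Rightarrow> 'e \<Rightarrow> 'e \<Rightarrow> real"

definition change_of_charts ::
  "('a, 'e::euclidean_space) chart set \<Rightarrow>
   (('a, 'e) chart \<Rightarrow> ('a, 'e) chart \<Rightarrow> 'e \<Rightarrow> 'e \<Rightarrow> ('e \<Rightarrow> 'e) \<Rightarrow> bool) \<Rightarrow> bool" where
  "change_of_charts A P \<longleftrightarrow>
     (\<forall>\<kappa>\<in>A. \<forall>\<kappa>'\<in>A. \<forall>p \<in> fst \<kappa> \<inter> fst \<kappa>'.
        P \<kappa> \<kappa>' (snd \<kappa> p) (snd \<kappa>' p) (frechet_derivative (transition \<kappa> \<kappa>') (at (snd \<kappa> p))))"

definition smooth_vector_field ::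
  "('a, 'e::euclidean_space) chart set \<Rightarrow> ('a, 'e) vector_field \<Rightarrow> bool" where
  "smooth_vector_field A X \<longleftrightarrow>
     (\<forall>\<kappa>\<in>A. smooth_on (chart_image \<kappa>) (X \<kappa>)) \<and>
     change_of_charts A (\<lambda>\<kappa> \<kappa>' x x' J. X \<kappa>' x' = J (X \<kappa> x))"

definition smooth_one_form ::
  "('a, 'e::euclidean_space) chart set \<Rightarrow> ('a, 'e) one_form \<Rightarrow> bool" where
  "smooth_one_form A \<omega> \<longleftrightarrow>
     (\<forall>\<kappa>\<in>A. (\<forall>x\<in>chart_image \<kappa>. linear (\<omega> \<kappa> x)) \<and>
        (\<forall>u. smooth_on (chart_image \<kappa>) (\<lambda>x. \<omega> \<kappa> x u))) \<and>
     change_of_charts A (\<lambda>\<kappa> \<kappa>' x x' J. \<forall>u. \<omega> \<kappa>' x' (J u) = \<omega> \<kappa> x u)"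

definition smooth_endo_field ::
  "('a, 'e::euclidean_space) chart set \<Rightarrow> ('a, 'e) endo_field \<Rightarrow> bool" where
  "smooth_endo_field A \<phi> \<longleftrightarrow>
     (\<forall>\<kappa>\<in>A. (\<forall>x\<in>chart_image \<kappa>. linear (\<phi> \<kappa> x)) \<and>
        (\<forall>u. smooth_on (chart_image \<kappa>) (\<lambda>x. \<phi> \<kappa> x u))) \<and>
     change_of_charts A (\<lambda>\<kappa> \<kappa>' x x' J. \<forall>u. \<phi> \<kappa>' x' (J u) = J (\<phi> \<kappa> x u))"

definition riemannian_metric ::
  "('a, 'e::euclidean_space) chart set \<Rightarrow> ('a, 'e) bilinear_field \<Rightarrow> bool" where
  "riemannian_metric A g \<longleftrightarrow>
     (\<forall>\<kappa>\<in>A. (\<forall>x\<in>chart_image \<kappa>. bilinear (g \<kappa> x) \<and>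
           (\<forall>u v. g \<kappa> x u v = g \<kappa> x v u) \<and> (\<forall>u. u \<noteq> 0 \<longrightarrow> g \<kappa> x u u > 0)) \<and>
        (\<forall>u v. smooth_on (chart_image \<kappa>) (\<lambda>x. g \<kappa> x u v))) \<and>
     change_of_charts A (\<lambda>\<kappa> \<kappa>' x x' J. \<forall>u v. g \<kappa>' x' (J u) (J v) = g \<kappa> x u v)"

definition differentiable_function ::
  "('a, 'e::euclidean_space) chart set \<Rightarrow> ('a \<Rightarrow> real) \<Rightarrow> bool" where
  "differentiable_function A f \<longleftrightarrow> (\<forall>\<kappa>\<in>A. (f \<circ> chart_inv \<kappa>) differentiable_on chart_image \<kappa>)"


section \<open>Differential operators in a chart\<close>

text \<open>From here on, fields are coordinate expressions in one chart.\<close>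

definition lie_bracket :: "('e::euclidean_space \<Rightarrow> 'e) \<Rightarrow> ('e \<Rightarrow> 'e) \<Rightarrow> 'e \<Rightarrow> 'e" where
  "lie_bracket X Y x =
     frechet_derivative Y (at x) (X x) - frechet_derivative X (at x) (Y x)"

text \<open>\<open>(L\<^sub>X \<phi>) Y = [X, \<phi> Y] - \<phi> [X, Y]\<close>, evaluated on the constant field \<open>Y = u\<close>.\<close>

definition lie_derivative_endo ::
  "('e::euclidean_space \<Rightarrow> 'e) \<Rightarrow> ('e \<Rightarrow> 'e \<Rightarrow> 'e) \<Rightarrow> 'e \<Rightarrow> 'e \<Rightarrow> 'e" where
  "lie_derivative_endo X \<phi> x u =
     lie_bracket X (\<lambda>y. \<phi> y u) x - \<phi> x (lie_bracket X (\<lambda>_. u) x)"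

text \<open>The convention \<open>2 d\<eta>(X, Y) = X \<eta>(Y) - Y \<eta>(X) - \<eta>([X, Y])\<close>, on constant fields.  The factor
  is the one for which \<open>d\<eta>(X, Y) = \<langle>X, \<phi> Y\<rangle>\<close> agrees with \<open>\<nabla>\<^sub>X \<xi> = - \<phi> X - \<phi> h X\<close>.\<close>

definition ext_deriv :: "('e::euclidean_space \<Rightarrow> 'e \<Rightarrow> real) \<Rightarrow> 'e \<Rightarrow> 'e \<Rightarrow> 'e \<Rightarrow> real" where
  "ext_deriv \<eta> x u v =
     (frechet_derivative (\<lambda>y. \<eta> y v) (at x) u - frechet_derivative (\<lambda>y. \<eta> y u) (at x) v) / 2"

text \<open>\<open>christoffel G x u v\<close> has components \<open>\<Gamma>\<^sup>k\<^sub>i\<^sub>j u\<^sup>i v\<^sup>j\<close>; it is given by the Koszul formula for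
  constant fields.\<close>

definition christoffel ::
  "('e::euclidean_space \<Rightarrow> 'e \<Rightarrow> 'e \<Rightarrow> real) \<Rightarrow> 'e \<Rightarrow> 'e \<Rightarrow> 'e \<Rightarrow> 'e" where
  "christoffel G x u v = (THE w. \<forall>z. G x w z =
     (frechet_derivative (\<lambda>y. G y v z) (at x) u + frechet_derivative (\<lambda>y. G y u z) (at x) v
      - frechet_derivative (\<lambda>y. G y u v) (at x) z) / 2)"

text \<open>The Levi-Civita connection \<open>\<nabla>\<^sub>X Y\<close>.\<close>

definition nabla ::
  "('e::euclidean_space \<Rightarrow> 'e \<Rightarrow> 'e \<Rightarrow> real) \<Rightarrow> ('e \<Rightarrow> 'e) \<Rightarrow> ('e \<Rightarrow> 'e) \<Rightarrow> 'e \<Rightarrow> 'e" where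
  "nabla G X Y x = frechet_derivative Y (at x) (X x) + christoffel G x (X x) (Y x)"

text \<open>\<open>R(u, v) w\<close>, computed with constant extensions of the three vectors.\<close>

definition curvature ::
  "('e::euclidean_space \<Rightarrow> 'e \<Rightarrow> 'e \<Rightarrow> real) \<Rightarrow> 'e \<Rightarrow> 'e \<Rightarrow> 'e \<Rightarrow> 'e \<Rightarrow> 'e" where
  "curvature G x u v w =
     (let X = (\<lambda>_. u); Y = (\<lambda>_. v); Z = (\<lambda>_. w) in
        nabla G X (nabla G Y Z) x - nabla G Y (nabla G X Z) x - nabla G (lie_bracket X Y) Z x)"

text \<open>Only meant for orthonormal \<open>u\<close>, \<open>v\<close>.\<close>

definition sectional_curvature ::
  "('e::euclidean_space \<Rightarrow> 'e \<Rightarrow> 'e \<Rightarrow> real) \<Rightarrow> 'e \<Rightarrow> 'e \<Rightarrow> 'e \<Rightarrow> real" where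
  "sectional_curvature G x u v = G x (curvature G x u v v) u"

text \<open>Orthonormal bases are indexed by \<open>0, \<dots>, n - 1\<close>, so \<open>e 0\<close> is the first basis vector.\<close>

definition orthonormal_basis ::
  "('e::euclidean_space \<Rightarrow> 'e \<Rightarrow> real) \<Rightarrow> (nat \<Rightarrow> 'e) \<Rightarrow> bool" where
  "orthonormal_basis ip e \<longleftrightarrow>
     (\<forall>i<DIM('e). \<forall>j<DIM('e). ip (e i) (e j) = (if i = j then 1 else 0))"

text \<open>The value does not depend on the choice of the basis.\<close>

definition ricci :: "('e::euclidean_space \<Rightarrow> 'e \<Rightarrow> 'e \<Rightarrow> real) \<Rightarrow> 'e \<Rightarrow> 'e \<Rightarrow> real" where
  "ricci G x u =
     (let e = (SOME e. orthonormal_basis (G x) e \<and> e 0 = u) in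
        \<Sum>j = 1..<DIM('e). sectional_curvature G x (e 0) (e j))"

definition endo_trace :: "('e::euclidean_space \<Rightarrow> 'e) \<Rightarrow> real" where
  "endo_trace L = (\<Sum>b\<in>Basis. L b \<bullet> b)"


section \<open>Generalized \<open>(\<kappa>, \<mu>)\<close>-contact space forms with divided \<open>R\<^sub>5\<close>\<close>

definition almost_contact_metric_manifold ::
  "'a topology \<Rightarrow> ('a, 'e::euclidean_space) chart set \<Rightarrow> ('a, 'e) endo_field \<Rightarrow>
   ('a, 'e) vector_field \<Rightarrow> ('a, 'e) one_form \<Rightarrow> ('a, 'e) bilinear_field \<Rightarrow> bool" where
  "almost_contact_metric_manifold T A \<phi> \<xi> \<eta> g \<longleftrightarrow>
     smooth_manifold T A \<and> smooth_endo_field A \<phi> \<and> smooth_vector_field A \<xi> \<and>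
     smooth_one_form A \<eta> \<and> riemannian_metric A g \<and>
     (\<forall>\<kappa>\<in>A. \<forall>x\<in>chart_image \<kappa>.
        (\<forall>X. \<phi> \<kappa> x (\<phi> \<kappa> x X) = - X + \<eta> \<kappa> x X *\<^sub>R \<xi> \<kappa> x) \<and>
        \<eta> \<kappa> x (\<xi> \<kappa> x) = 1 \<and>
        (\<forall>X. \<eta> \<kappa> x (\<phi> \<kappa> x X) = 0) \<and>
        \<phi> \<kappa> x (\<xi> \<kappa> x) = 0 \<and>
        (\<forall>X Y. g \<kappa> x X Y = g \<kappa> x (\<phi> \<kappa> x X) (\<phi> \<kappa> x Y) + \<eta> \<kappa> x X * \<eta> \<kappa> x Y) \<and>
        (\<forall>X. g \<kappa> x X (\<xi> \<kappa> x) = \<eta> \<kappa> x X) \<and>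
        (\<forall>X Y. g \<kappa> x X (\<phi> \<kappa> x Y) = - g \<kappa> x (\<phi> \<kappa> x X) Y))"

definition contact_metric_manifold ::
  "'a topology \<Rightarrow> ('a, 'e::euclidean_space) chart set \<Rightarrow> ('a, 'e) endo_field \<Rightarrow>
   ('a, 'e) vector_field \<Rightarrow> ('a, 'e) one_form \<Rightarrow> ('a, 'e) bilinear_field \<Rightarrow> bool" where
  "contact_metric_manifold T A \<phi> \<xi> \<eta> g \<longleftrightarrow>
     almost_contact_metric_manifold T A \<phi> \<xi> \<eta> g \<and>
     (\<forall>\<kappa>\<in>A. \<forall>x\<in>chart_image \<kappa>. \<forall>X Y. ext_deriv (\<eta> \<kappa>) x X Y = g \<kappa> x X (\<phi> \<kappa> x Y))"

definition structure_h ::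
  "('a, 'e::euclidean_space) endo_field \<Rightarrow> ('a, 'e) vector_field \<Rightarrow> ('a, 'e) endo_field" where
  "structure_h \<phi> \<xi> \<kappa> x X = (1 / 2) *\<^sub>R lie_derivative_endo (\<xi> \<kappa>) (\<phi> \<kappa>) x X"

text \<open>The model curvature tensors at a single point; \<open>ip\<close> is the metric there.\<close>

context
  fixes ip :: "'e::euclidean_space \<Rightarrow> 'e \<Rightarrow> real" and \<phi> :: "'e \<Rightarrow> 'e" and \<xi> :: 'e
    and \<eta> :: "'e \<Rightarrow> real" and h :: "'e \<Rightarrow> 'e"
begin

definition R1 :: "'e \<Rightarrow> 'e \<Rightarrow> 'e \<Rightarrow> 'e" where
  "R1 X Y Z = ip Y Z *\<^sub>R X - ip X Z *\<^sub>R Y"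

definition R2 :: "'e \<Rightarrow> 'e \<Rightarrow> 'e \<Rightarrow> 'e" where
  "R2 X Y Z = ip X (\<phi> Z) *\<^sub>R \<phi> Y - ip Y (\<phi> Z) *\<^sub>R \<phi> X + (2 * ip X (\<phi> Y)) *\<^sub>R \<phi> Z"

definition R3 :: "'e \<Rightarrow> 'e \<Rightarrow> 'e \<Rightarrow> 'e" where
  "R3 X Y Z = (\<eta> X * \<eta> Z) *\<^sub>R Y - (\<eta> Y * \<eta> Z) *\<^sub>R X
     + (ip X Z * \<eta> Y) *\<^sub>R \<xi> - (ip Y Z * \<eta> X) *\<^sub>R \<xi>"

definition R4 :: "'e \<Rightarrow> 'e \<Rightarrow> 'e \<Rightarrow> 'e" where
  "R4 X Y Z = ip Y Z *\<^sub>R h X - ip X Z *\<^sub>R h Y + ip (h Y) Z *\<^sub>R X - ip (h X) Z *\<^sub>R Y"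

definition R51 :: "'e \<Rightarrow> 'e \<Rightarrow> 'e \<Rightarrow> 'e" where
  "R51 X Y Z = ip (h Y) Z *\<^sub>R h X - ip (h X) Z *\<^sub>R h Y"

definition R52 :: "'e \<Rightarrow> 'e \<Rightarrow> 'e \<Rightarrow> 'e" where
  "R52 X Y Z = ip (\<phi> (h Y)) Z *\<^sub>R \<phi> (h X) - ip (\<phi> (h X)) Z *\<^sub>R \<phi> (h Y)"

definition R6 :: "'e \<Rightarrow> 'e \<Rightarrow> 'e \<Rightarrow> 'e" where
  "R6 X Y Z = (\<eta> X * \<eta> Z) *\<^sub>R h Y - (\<eta> Y * \<eta> Z) *\<^sub>R h X
     + (ip (h X) Z * \<eta> Y) *\<^sub>R \<xi> - (ip (h Y) Z * \<eta> X) *\<^sub>R \<xi>"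

end

definition gen_space_form_divided_R5 ::
  "'a topology \<Rightarrow> ('a, 'e::euclidean_space) chart set \<Rightarrow> ('a, 'e) endo_field \<Rightarrow>
   ('a, 'e) vector_field \<Rightarrow> ('a, 'e) one_form \<Rightarrow> ('a, 'e) bilinear_field \<Rightarrow>
   ('a \<Rightarrow> real) \<Rightarrow> ('a \<Rightarrow> real) \<Rightarrow> ('a \<Rightarrow> real) \<Rightarrow> ('a \<Rightarrow> real) \<Rightarrow> ('a \<Rightarrow> real) \<Rightarrow> ('a \<Rightarrow> real) \<Rightarrow>
   ('a \<Rightarrow> real) \<Rightarrow> bool" where
  "gen_space_form_divided_R5 T A \<phi> \<xi> \<eta> g f1 f2 f3 f4 f51 f52 f6 \<longleftrightarrow>
     almost_contact_metric_manifold T A \<phi> \<xi> \<eta> g \<and>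
     (\<forall>f\<in>{f1, f2, f3, f4, f51, f52, f6}. differentiable_function A f) \<and>
     (\<forall>\<kappa>\<in>A. \<forall>q\<in>fst \<kappa>. \<forall>X Y Z.
        let x = snd \<kappa> q; ip = g \<kappa> x; \<Phi> = \<phi> \<kappa> x; h = structure_h \<phi> \<xi> \<kappa> x in
        curvature (g \<kappa>) x X Y Z =
          f1 q *\<^sub>R R1 ip X Y Z + f2 q *\<^sub>R R2 ip \<Phi> X Y Z + f3 q *\<^sub>R R3 ip (\<xi> \<kappa> x) (\<eta> \<kappa> x) X Y Z
          + f4 q *\<^sub>R R4 ip h X Y Z + f51 q *\<^sub>R R51 ip h X Y Z + f52 q *\<^sub>R R52 ip \<Phi> h X Y Z
          + f6 q *\<^sub>R R6 ip (\<xi> \<kappa> x) (\<eta> \<kappa> x) h X Y Z)"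

definition gen_contact_space_form_divided_R5 ::
  "'a topology \<Rightarrow> ('a, 'e::euclidean_space) chart set \<Rightarrow> ('a, 'e) endo_field \<Rightarrow>
   ('a, 'e) vector_field \<Rightarrow> ('a, 'e) one_form \<Rightarrow> ('a, 'e) bilinear_field \<Rightarrow>
   ('a \<Rightarrow> real) \<Rightarrow> ('a \<Rightarrow> real) \<Rightarrow> ('a \<Rightarrow> real) \<Rightarrow> ('a \<Rightarrow> real) \<Rightarrow> ('a \<Rightarrow> real) \<Rightarrow> ('a \<Rightarrow> real) \<Rightarrow>
   ('a \<Rightarrow> real) \<Rightarrow> bool" where
  "gen_contact_space_form_divided_R5 T A \<phi> \<xi> \<eta> g f1 f2 f3 f4 f51 f52 f6 \<longleftrightarrow>
     gen_space_form_divided_R5 T A \<phi> \<xi> \<eta> g f1 f2 f3 f4 f51 f52 f6 \<and>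
     contact_metric_manifold T A \<phi> \<xi> \<eta> g"


section \<open>Submanifolds\<close>

text \<open>Immersed submanifolds: \<open>M\<close> is a subset of the ambient manifold with its own topology and
  smooth structure, for which the inclusion map is a smooth immersion.\<close>

definition submanifold ::
  "'a topology \<Rightarrow> ('a, 'd::euclidean_space) chart set \<Rightarrow>
   'a topology \<Rightarrow> ('a, 'e::euclidean_space) chart set \<Rightarrow> bool" where
  "submanifold M B T A \<longleftrightarrow>
     smooth_manifold M B \<and> smooth_manifold T A \<and>
     topspace M \<subseteq> topspace T \<and> continuous_map M T id \<and>
     (\<forall>\<psi>\<in>B. \<forall>\<kappa>\<in>A.
        smooth_on (snd \<psi> ` (fst \<psi> \<inter> fst \<kappa>)) (transition \<psi> \<kappa>) \<and>
        (\<forall>p \<in> fst \<psi> \<inter> fst \<kappa>. inj (frechet_derivative (transition \<psi> \<kappa>) (at (snd \<psi> p)))))"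

definition C_totally_real ::
  "('a, 'd::euclidean_space) chart set \<Rightarrow> ('a, 'e::euclidean_space) chart set \<Rightarrow>
   ('a, 'e) vector_field \<Rightarrow> ('a, 'e) bilinear_field \<Rightarrow> bool" where
  "C_totally_real B A \<xi> g \<longleftrightarrow>
     (\<forall>\<psi>\<in>B. \<forall>\<kappa>\<in>A. \<forall>p \<in> fst \<psi> \<inter> fst \<kappa>. \<forall>u.
        g \<kappa> (snd \<kappa> p) (\<xi> \<kappa> (snd \<kappa> p))
          (frechet_derivative (transition \<psi> \<kappa>) (at (snd \<psi> p)) u) = 0)"

text \<open>In the following, \<open>G\<close> is the ambient metric in an ambient chart and \<open>F\<close> the coordinate
  expression of the inclusion.  Vectors tangent to \<open>M\<close> are given by their components in a
  chart of \<open>M\<close>; the corresponding ambient vector is their image under the differential of \<open>F\<close>.\<close>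

definition push ::
  "('d::euclidean_space \<Rightarrow> 'e::euclidean_space) \<Rightarrow> 'd \<Rightarrow> 'd \<Rightarrow> 'e" where
  "push F x u = frechet_derivative F (at x) u"

definition induced_metric ::
  "('e::euclidean_space \<Rightarrow> 'e \<Rightarrow> 'e \<Rightarrow> real) \<Rightarrow> ('d::euclidean_space \<Rightarrow> 'e) \<Rightarrow>
   'd \<Rightarrow> 'd \<Rightarrow> 'd \<Rightarrow> real" where
  "induced_metric G F x u v = G (F x) (push F x u) (push F x v)"

text \<open>The tangential component of an ambient vector \<open>w\<close> at \<open>F x\<close>, as a vector tangent to \<open>M\<close>.\<close>

definition tangential ::
  "('e::euclidean_space \<Rightarrow> 'e \<Rightarrow> 'e \<Rightarrow> real) \<Rightarrow> ('d::euclidean_space \<Rightarrow> 'e) \<Rightarrow> 'd \<Rightarrow> 'e \<Rightarrow> 'd" where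
  "tangential G F x w = (THE u. \<forall>v. G (F x) (w - push F x u) (push F x v) = 0)"

text \<open>The ambient derivative \<open>\<nabla>\<^sub>u v\<close> along \<open>M\<close>, where \<open>v\<close> is extended to a tangent field of \<open>M\<close>
  with constant components.\<close>

definition ambient_nabla ::
  "('e::euclidean_space \<Rightarrow> 'e \<Rightarrow> 'e \<Rightarrow> real) \<Rightarrow> ('d::euclidean_space \<Rightarrow> 'e) \<Rightarrow>
   'd \<Rightarrow> 'd \<Rightarrow> 'd \<Rightarrow> 'e" where
  "ambient_nabla G F x u v =
     frechet_derivative (\<lambda>y. push F y v) (at x) u + christoffel G (F x) (push F x u) (push F x v)"

definition second_fundamental_form ::
  "('e::euclidean_space \<Rightarrow> 'e \<Rightarrow> 'e \<Rightarrow> real) \<Rightarrow> ('d::euclidean_space \<Rightarrow> 'e) \<Rightarrow>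
   'd \<Rightarrow> 'd \<Rightarrow> 'd \<Rightarrow> 'e" where
  "second_fundamental_form G F x u v =
     ambient_nabla G F x u v - push F x (tangential G F x (ambient_nabla G F x u v))"

text \<open>The value does not depend on the choice of the basis.\<close>

definition mean_curvature ::
  "('e::euclidean_space \<Rightarrow> 'e \<Rightarrow> 'e \<Rightarrow> real) \<Rightarrow> ('d::euclidean_space \<Rightarrow> 'e) \<Rightarrow> 'd \<Rightarrow> 'e" where
  "mean_curvature G F x =
     (let e = (SOME e. orthonormal_basis (induced_metric G F x) e) in
        (1 / real DIM('d)) *\<^sub>R (\<Sum>i<DIM('d). second_fundamental_form G F x (e i) (e i)))"

definition relative_null_space ::
  "('e::euclidean_space \<Rightarrow> 'e \<Rightarrow> 'e \<Rightarrow> real) \<Rightarrow> ('d::euclidean_space \<Rightarrow> 'e) \<Rightarrow> 'd \<Rightarrow> 'd set" where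
  "relative_null_space G F x = {u. \<forall>v. second_fundamental_form G F x u v = 0}"

definition totally_geodesic_at ::
  "('e::euclidean_space \<Rightarrow> 'e \<Rightarrow> 'e \<Rightarrow> real) \<Rightarrow> ('d::euclidean_space \<Rightarrow> 'e) \<Rightarrow> 'd \<Rightarrow> bool" where
  "totally_geodesic_at G F x \<longleftrightarrow> (\<forall>u v. second_fundamental_form G F x u v = 0)"

definition totally_umbilical_at ::
  "('e::euclidean_space \<Rightarrow> 'e \<Rightarrow> 'e \<Rightarrow> real) \<Rightarrow> ('d::euclidean_space \<Rightarrow> 'e) \<Rightarrow> 'd \<Rightarrow> bool" where
  "totally_umbilical_at G F x \<longleftrightarrow>
     (\<forall>u v. second_fundamental_form G F x u v = induced_metric G F x u v *\<^sub>R mean_curvature G F x)"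

end

theory Submission
  imports Defs
begin

text \<open>
  In charts, the Gauss equation writes the curvature of the induced metric as the ambient curvature
  plus products of values of the second fundamental form \<open>\<sigma>\<close>. On a \<open>C\<close>-totally real submanifold
  \<open>\<phi>\<close> maps tangent vectors to normal ones, because \<open>d\<eta>\<close> restricts to zero, so \<open>R\<^sub>2\<close>, \<open>R\<^sub>3\<close> and \<open>R\<^sub>6\<close>
  drop out; the symmetry of \<open>h\<close> and \<open>\<phi> h\<close> turns the other tensors into the stated trace terms.
  For an orthonormal basis \<open>e\<^sub>0 = U, e\<^sub>1, \<dots>\<close> the two sides of the inequality then differ by
  \<open>\<parallel>2 \<sigma>(U, U) - n H\<parallel>\<^sup>2 / 4 + (\<Sum>j\<ge>1. \<parallel>\<sigma>(U, e\<^sub>j)\<parallel>\<^sup>2)\<close>. If this vanishes for every unit \<open>U\<close>, summing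
  \<open>2 \<sigma>(U, U) = n H\<close> over a basis gives \<open>2 n H = n\<^sup>2 H\<close>, so \<open>H = 0\<close> and \<open>\<sigma> = 0\<close> when \<open>n \<noteq> 2\<close>.
\<close>

section \<open>Calculus of iterated derivatives\<close>

text \<open>The symmetry of \<open>h\<close> and \<open>\<phi> h\<close> has to be derived from the
  structure equations. The route is the Lie derivative of the metric G along \<xi>: because \<Phi> =
  d\<eta> is closed and vanishes on \<xi>, its Lie derivative along \<xi> is zero, and the Leibniz
  rule for \<Phi>(u, v) = G(u, \<phi> v) turns this into (L_\<xi> G)(u, \<phi> v) = - 2 G(u, h v).
  Both symmetries follow from the symmetry of L_\<xi> G and from its change of sign when \<phi> is
  applied in both slots. The analytic obstacle is that Christoffel vectors are given by a definite
  description. They are recognized as solutions of a linear system whose matrix is the metric, and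
  differentiability of the coefficients is transferred to the solution. The connection theory is
  therefore set up for any metric whose first partial derivatives exist and are differentiable. The
  ambient and the induced metric both qualify, so one theory serves on both sides of the Gauss
  equation.\<close>

abbreviation D :: "('a::real_normed_vector \<Rightarrow> 'b::real_normed_vector) \<Rightarrow> 'a \<Rightarrow> 'a \<Rightarrow> 'b" where
  "D f x \<equiv> frechet_derivative f (at x)"

lemma D_eqI: "(f has_derivative f') (at x) \<Longrightarrow> D f x = f'"
  by (rule frechet_derivative_at[symmetric])

lemma D_works: "f differentiable at x \<Longrightarrow> (f has_derivative D f x) (at x)"
  by (simp add: frechet_derivative_works)

lemma differentiable_cong_open:
  assumes "open S" "x \<in> S" "\<And>y. y \<in> S \<Longrightarrow> f y = g y" "f differentiable at x"
  shows "g differentiable at x"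
  using assms has_derivative_transform_within_open unfolding differentiable_def by blast

lemma D_cong_open:
  assumes "open S" "x \<in> S" "\<And>y. y \<in> S \<Longrightarrow> f y = g y" "f differentiable at x"
  shows "D f x = D g x"
  using D_eqI[OF has_derivative_transform_within_open[OF D_works[OF assms(4)] assms(1,2,3)]] by simp

lemma smooth_on_differentiable: "smooth_on S f \<Longrightarrow> x \<in> S \<Longrightarrow> f differentiable at x"
  unfolding smooth_on_def using Ck_on.simps(2) by blast

lemma smooth_on_D: "smooth_on S f \<Longrightarrow> smooth_on S (\<lambda>x. D f x v)"
  unfolding smooth_on_def using Ck_on.simps(2) by blast

lemma smooth_on_continuous: "smooth_on S f \<Longrightarrow> continuous_on S f"
  unfolding smooth_on_def by (metis Ck_on.simps(1))

section \<open>Symmetry of mixed partial derivatives\<close>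

text \<open>The left side of the equation does not change when \<open>u\<close> and \<open>v\<close>
  are swapped, so two instances compare the two mixed derivatives. One mean value step along
  \<open>u\<close> and one along \<open>v\<close> produce the intermediate point.\<close>

lemma second_difference_mean_value:
  fixes f :: "'a::real_normed_vector \<Rightarrow> real"
  assumes S: "\<And>a b. 0 \<le> a \<Longrightarrow> a \<le> t \<Longrightarrow> 0 \<le> b \<Longrightarrow> b \<le> t \<Longrightarrow> x + a *\<^sub>R u + b *\<^sub>R v \<in> S"
    and f: "\<And>y. y \<in> S \<Longrightarrow> f differentiable at y"
    and fu: "\<And>y. y \<in> S \<Longrightarrow> (\<lambda>y. D f y u) differentiable at y"
    and t: "t > 0"
  obtains a b where "0 \<le> a" "a \<le> t" "0 \<le> b" "b \<le> t"
    "f (x + t *\<^sub>R u + t *\<^sub>R v) - f (x + t *\<^sub>R u) - (f (x + t *\<^sub>R v) - f x)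
      = t\<^sup>2 * D (\<lambda>y. D f y u) (x + a *\<^sub>R u + b *\<^sub>R v) v"
proof -
  \<comment> \<open>The increment along \<open>v\<close> as a function of the position along
    \<open>u\<close>. The summand \<open>0 *\<^sub>R v\<close> gives both terms the shape treated by
    \<open>shift\<close>.\<close>
  define \<gamma> where "\<gamma> s = f (x + s *\<^sub>R u + t *\<^sub>R v) - f (x + s *\<^sub>R u + 0 *\<^sub>R v)" for s
  have shift: "((\<lambda>s. f (x + s *\<^sub>R u + b *\<^sub>R v)) has_real_derivative D f (x + a *\<^sub>R u + b *\<^sub>R v) u) (at a)"
    if "0 \<le> a" "a \<le> t" "0 \<le> b" "b \<le> t" for a b
  proof -
    have *: "(f has_derivative D f (x + a *\<^sub>R u + b *\<^sub>R v)) (at (x + a *\<^sub>R u + b *\<^sub>R v))"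
      using that by (intro D_works f S)
    have "((\<lambda>s. x + s *\<^sub>R u + b *\<^sub>R v) has_derivative (\<lambda>s. s *\<^sub>R u)) (at a)"
      by (auto intro!: derivative_eq_intros)
    from has_derivative_compose[OF this *]
    show ?thesis
      using linear_frechet_derivative[OF f[OF S[OF that]]]
      unfolding has_field_derivative_def
      by (elim has_derivative_eq_rhs) (auto simp: linear_cmul mult.commute)
  qed
  have shift2: "((\<lambda>s. D f (x + a *\<^sub>R u + s *\<^sub>R v) u) has_real_derivative
      D (\<lambda>y. D f y u) (x + a *\<^sub>R u + b *\<^sub>R v) v) (at b)"
    if "0 \<le> a" "a \<le> t" "0 \<le> b" "b \<le> t" for a b
  proof -
    have *: "((\<lambda>y. D f y u) has_derivative D (\<lambda>y. D f y u) (x + a *\<^sub>R u + b *\<^sub>R v)) (at (x + a *\<^sub>R u + b *\<^sub>R v))"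
      using that by (intro D_works fu S)
    have "((\<lambda>s. x + a *\<^sub>R u + s *\<^sub>R v) has_derivative (\<lambda>s. s *\<^sub>R v)) (at b)"
      by (auto intro!: derivative_eq_intros)
    from has_derivative_compose[OF this *]
    show ?thesis
      using linear_frechet_derivative[OF fu[OF S[OF that]]]
      unfolding has_field_derivative_def
      by (elim has_derivative_eq_rhs) (auto simp: linear_cmul mult.commute)
  qed
  have "\<exists>z>0. z < t \<and> \<gamma> t - \<gamma> 0 =
      (t - 0) * (D f (x + z *\<^sub>R u + t *\<^sub>R v) u - D f (x + z *\<^sub>R u + 0 *\<^sub>R v) u)"
    unfolding \<gamma>_def using t by (intro MVT2 DERIV_diff shift) auto
  then obtain a where a: "0 < a" "a < t"
    "\<gamma> t - \<gamma> 0 = t * (D f (x + a *\<^sub>R u + t *\<^sub>R v) u - D f (x + a *\<^sub>R u + 0 *\<^sub>R v) u)" by auto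
  have "\<exists>z>0. z < t \<and> D f (x + a *\<^sub>R u + t *\<^sub>R v) u - D f (x + a *\<^sub>R u + 0 *\<^sub>R v) u =
      (t - 0) * D (\<lambda>y. D f y u) (x + a *\<^sub>R u + z *\<^sub>R v) v"
    using t a by (intro MVT2 shift2) auto
  then obtain b where b: "0 < b" "b < t" "D f (x + a *\<^sub>R u + t *\<^sub>R v) u - D f (x + a *\<^sub>R u + 0 *\<^sub>R v) u =
      t * D (\<lambda>y. D f y u) (x + a *\<^sub>R u + b *\<^sub>R v) v" by auto
  show ?thesis
    using a b by (intro that[of a b]) (auto simp: \<gamma>_def power2_eq_square algebra_simps)
qed

lemma D_commute_real:
  fixes f :: "'a::real_normed_vector \<Rightarrow> real"
  assumes S: "open S" "x \<in> S" and f: "smooth_on S f"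
  shows "D (\<lambda>y. D f y u) x v = D (\<lambda>y. D f y v) x u"
proof (rule ccontr)
  let ?P = "\<lambda>y. D (\<lambda>y. D f y u) y v" and ?Q = "\<lambda>y. D (\<lambda>y. D f y v) y u"
  assume "?P x \<noteq> ?Q x"
  \<comment> \<open>Half the gap: values closer than \<epsilon> to \<open>?P x\<close> and to
    \<open>?Q x\<close> cannot coincide.\<close>
  define \<epsilon> where "\<epsilon> = \<bar>?P x - ?Q x\<bar> / 2"
  with \<open>?P x \<noteq> ?Q x\<close> have "\<epsilon> > 0" by simp
  have "continuous (at x) ?P" "continuous (at x) ?Q"
    using smooth_on_continuous[OF smooth_on_D[OF smooth_on_D[OF f]]] S
    by (simp_all add: continuous_on_eq_continuous_at)
  with \<open>\<epsilon> > 0\<close> obtain d1 d2 where d: "d1 > 0" "\<And>y. dist y x < d1 \<Longrightarrow> dist (?P y) (?P x) < \<epsilon>"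
    "d2 > 0" "\<And>y. dist y x < d2 \<Longrightarrow> dist (?Q y) (?Q x) < \<epsilon>"
    unfolding continuous_at_eps_delta by metis
  obtain r where r: "r > 0" "ball x r \<subseteq> S" using S openE by blast
  define d where "d = min r (min d1 d2)"
  have "d > 0" using d r by (simp add: d_def)
  \<comment> \<open>Makes the whole parallelogram stay within d / 2 of x; the summand 1 covers the
    case u = v = 0.\<close>
  define t where "t = d / 2 / (norm u + norm v + 1)"
  have N: "norm u + norm v + 1 > 0" by (simp add: add_nonneg_pos)
  have "t > 0" using \<open>d > 0\<close> N by (simp add: t_def)
  have small: "dist (x + a *\<^sub>R u + b *\<^sub>R v) x < d"
    if "0 \<le> a" "a \<le> t" "0 \<le> b" "b \<le> t" for a b
  proof -
    have "dist (x + a *\<^sub>R u + b *\<^sub>R v) x \<le> norm (a *\<^sub>R u) + norm (b *\<^sub>R v)"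
      by (simp add: dist_norm) (metis norm_scaleR norm_triangle_ineq)
    also have "\<dots> \<le> t * norm u + t * norm v"
      using that by (auto intro!: add_mono mult_right_mono)
    also have "\<dots> \<le> t * (norm u + norm v + 1)" using \<open>t > 0\<close> by (simp add: algebra_simps)
    also have "\<dots> = d / 2" using N by (simp only: t_def) (simp add: field_simps)
    finally show ?thesis using \<open>d > 0\<close> by simp
  qed
  have inS: "x + a *\<^sub>R u + b *\<^sub>R v \<in> S" if "0 \<le> a" "a \<le> t" "0 \<le> b" "b \<le> t" for a b
    using small[OF that] r by (auto simp: d_def dist_commute subset_eq)
  have inS': "x + a *\<^sub>R v + b *\<^sub>R u \<in> S" if "0 \<le> a" "a \<le> t" "0 \<le> b" "b \<le> t" for a b
    using inS[OF that(3,4,1,2)] by (simp add: algebra_simps)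
  note df = smooth_on_differentiable[OF f] smooth_on_differentiable[OF smooth_on_D[OF f]]
  obtain a b where ab: "0 \<le> a" "a \<le> t" "0 \<le> b" "b \<le> t"
    "f (x + t *\<^sub>R u + t *\<^sub>R v) - f (x + t *\<^sub>R u) - (f (x + t *\<^sub>R v) - f x)
      = t\<^sup>2 * ?P (x + a *\<^sub>R u + b *\<^sub>R v)"
    by (rule second_difference_mean_value[of t x u v S f, OF inS df \<open>t > 0\<close>])
  obtain a' b' where ab': "0 \<le> a'" "a' \<le> t" "0 \<le> b'" "b' \<le> t"
    "f (x + t *\<^sub>R v + t *\<^sub>R u) - f (x + t *\<^sub>R v) - (f (x + t *\<^sub>R u) - f x)
      = t\<^sup>2 * ?Q (x + a' *\<^sub>R v + b' *\<^sub>R u)"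
    by (rule second_difference_mean_value[of t x v u S f, OF inS' df \<open>t > 0\<close>])
  have "t\<^sup>2 * ?P (x + a *\<^sub>R u + b *\<^sub>R v) = t\<^sup>2 * ?Q (x + a' *\<^sub>R v + b' *\<^sub>R u)"
    unfolding ab(5)[symmetric] ab'(5)[symmetric] by (simp add: algebra_simps)
  then have "?P (x + a *\<^sub>R u + b *\<^sub>R v) = ?Q (x + a' *\<^sub>R v + b' *\<^sub>R u)"
    using \<open>t > 0\<close> by simp
  moreover have "dist (?P (x + a *\<^sub>R u + b *\<^sub>R v)) (?P x) < \<epsilon>"
    using small[OF ab(1-4)] d(2) by (simp add: d_def)
  moreover have "dist (?Q (x + a' *\<^sub>R v + b' *\<^sub>R u)) (?Q x) < \<epsilon>"
    using small[OF ab'(3,4,1,2)] d(4) by (simp add: d_def algebra_simps)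
  ultimately show False by (simp add: \<epsilon>_def dist_real_def abs_if split: if_splits)
qed

lemma D_inner:
  assumes "f differentiable at x"
  shows "D (\<lambda>y. f y \<bullet> b) x v = D f x v \<bullet> b"
  using D_eqI[OF has_derivative_inner_left[OF D_works[OF assms], of b]] by simp

lemma Ck_on_cong_open:
  assumes S: "open S" and "\<And>x. x \<in> S \<Longrightarrow> f x = g x" "Ck_on k S f"
  shows "Ck_on k S g"
  using assms(2,3)
proof (induction k arbitrary: f g)
  case 0
  then show ?case using continuous_on_cong by fastforce
next
  case (Suc k)
  have "g differentiable at x" if "x \<in> S" for x
    using differentiable_cong_open[OF S that Suc.prems(1)] Suc.prems(2) that by auto
  moreover have "Ck_on k S (\<lambda>x. D g x v)" for v
  proof (rule Suc.IH)
    show "Ck_on k S (\<lambda>x. D f x v)" using Suc.prems(2) by simp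
    show "D f x v = D g x v" if "x \<in> S" for x
      using D_cong_open[OF S that Suc.prems(1)] Suc.prems(2) that by auto
  qed
  ultimately show ?case by simp
qed

lemma smooth_on_inner:
  assumes "open S" "smooth_on S f"
  shows "smooth_on S (\<lambda>x. f x \<bullet> b)"
proof -
  have "Ck_on k S (\<lambda>x. f x \<bullet> b)" if "smooth_on S f" for k f
    using that
  proof (induction k arbitrary: f)
    case 0
    then show ?case by (auto dest!: smooth_on_continuous intro!: continuous_intros)
  next
    case (Suc k)
    have "Ck_on k S (\<lambda>x. D (\<lambda>x. f x \<bullet> b) x v)" for v
      by (rule Ck_on_cong_open[OF assms(1) _ Suc.IH[OF smooth_on_D[OF Suc.prems, of v]]])
        (simp add: D_inner smooth_on_differentiable[OF Suc.prems])
    moreover have "(\<lambda>x. f x \<bullet> b) differentiable at x" if "x \<in> S" for x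
      using smooth_on_differentiable[OF Suc.prems that] by (intro differentiable_inner) auto
    ultimately show ?case by simp
  qed
  with assms(2) show ?thesis by (simp add: smooth_on_def)
qed

text \<open>The real case, tested against every vector \<open>b\<close>.\<close>

proposition D_commute:
  fixes f :: "'a::real_normed_vector \<Rightarrow> 'b::real_inner"
  assumes S: "open S" "x \<in> S" and f: "smooth_on S f"
  shows "D (\<lambda>y. D f y u) x v = D (\<lambda>y. D f y v) x u"
proof (rule vector_eq_rdot[THEN iffD1], intro allI)
  fix b
  have *: "D (\<lambda>y. D f y u) x v \<bullet> b = D (\<lambda>y. D (\<lambda>y. f y \<bullet> b) y u) x v" for u v
  proof -
    have "D (\<lambda>y. D f y u) x v \<bullet> b = D (\<lambda>y. D f y u \<bullet> b) x v"
      using D_inner smooth_on_differentiable[OF smooth_on_D[OF f] S(2)] by metis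
    also have "\<dots> = D (\<lambda>y. D (\<lambda>y. f y \<bullet> b) y u) x v"
    proof (rule fun_cong[OF D_cong_open[OF S]])
      show "(\<lambda>y. D f y u \<bullet> b) differentiable at x"
        using smooth_on_differentiable[OF smooth_on_D[OF f] S(2)] by (intro differentiable_inner) auto
    qed (simp add: D_inner smooth_on_differentiable[OF f])
    finally show ?thesis .
  qed
  show "D (\<lambda>y. D f y u) x v \<bullet> b = D (\<lambda>y. D f y v) x u \<bullet> b"
    unfolding * by (rule D_commute_real[OF S smooth_on_inner[OF S(1) f]])
qed

section \<open>Product rules and linear systems under weak differentiability\<close>

text \<open>A product rule that asks for differentiability of \<open>L y w\<close> at each fixed
  \<open>w\<close> only. In L y (V y) = L y (V x) + L y (V y - V x) the last term is expanded in the
  standard basis; its coefficients vanish at x, so the derivatives of \<open>L y b\<close> drop out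
  there.\<close>

lemma has_derivative_linear_family:
  fixes L :: "'a::real_normed_vector \<Rightarrow> 'b::euclidean_space \<Rightarrow> 'c::real_normed_vector"
  assumes S: "open S" "x \<in> S" and lin: "\<And>y. y \<in> S \<Longrightarrow> linear (L y)"
    and L: "\<And>w. (\<lambda>y. L y w) differentiable at x"
    and V: "(V has_derivative V') (at x)"
  shows "((\<lambda>y. L y (V y)) has_derivative (\<lambda>h. D (\<lambda>y. L y (V x)) x h + L x (V' h))) (at x)"
proof (rule has_derivative_transform_within_open[OF _ S])
  show "((\<lambda>y. L y (V x) + (\<Sum>b\<in>Basis. ((V y - V x) \<bullet> b) *\<^sub>R L y b)) has_derivative
      (\<lambda>h. D (\<lambda>y. L y (V x)) x h + L x (V' h))) (at x)"
  proof (rule has_derivative_eq_rhs)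
    show "((\<lambda>y. L y (V x) + (\<Sum>b\<in>Basis. ((V y - V x) \<bullet> b) *\<^sub>R L y b)) has_derivative
      (\<lambda>h. D (\<lambda>y. L y (V x)) x h + (\<Sum>b\<in>Basis. ((V x - V x) \<bullet> b) *\<^sub>R D (\<lambda>y. L y b) x h
        + ((V' h - 0) \<bullet> b) *\<^sub>R L x b))) (at x)"
      by (intro has_derivative_add has_derivative_sum has_derivative_scaleR D_works L
          has_derivative_inner_left has_derivative_diff V has_derivative_const)
    have "L x w = (\<Sum>b\<in>Basis. (w \<bullet> b) *\<^sub>R L x b)" for w
      by (subst (1) euclidean_representation[of w, symmetric])
        (simp add: linear_sum[OF lin[OF S(2)]] linear_cmul[OF lin[OF S(2)]])
    from this[of "V' _"] show "(\<lambda>h. D (\<lambda>y. L y (V x)) x h + (\<Sum>b\<in>Basis. ((V x - V x) \<bullet> b) *\<^sub>R D (\<lambda>y. L y b) x h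
        + ((V' h - 0) \<bullet> b) *\<^sub>R L x b)) = (\<lambda>h. D (\<lambda>y. L y (V x)) x h + L x (V' h))" by simp
  qed
next
  fix y assume y: "y \<in> S"
  have *: "L y (V y - V x) = (\<Sum>b\<in>Basis. ((V y - V x) \<bullet> b) *\<^sub>R L y b)"
    by (subst (1) euclidean_representation[of "V y - V x", symmetric])
      (simp add: linear_sum[OF lin[OF y]] linear_cmul[OF lin[OF y]])
  then show "L y (V x) + (\<Sum>b\<in>Basis. ((V y - V x) \<bullet> b) *\<^sub>R L y b) = L y (V y)"
    unfolding *[symmetric] by (simp add: linear_diff[OF lin[OF y]])
qed

lemma has_derivative_bilinear_family:
  fixes B :: "'a::real_normed_vector \<Rightarrow> 'b::euclidean_space \<Rightarrow> 'c::euclidean_space \<Rightarrow> 'f::real_normed_vector"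
  assumes S: "open S" "x \<in> S" and lin: "\<And>y. y \<in> S \<Longrightarrow> bilinear (B y)"
    and B: "\<And>v w. (\<lambda>y. B y v w) differentiable at x"
    and V: "(V has_derivative V') (at x)" and W: "(W has_derivative W') (at x)"
  shows "((\<lambda>y. B y (V y) (W y)) has_derivative
    (\<lambda>h. D (\<lambda>y. B y (V x) (W x)) x h + B x (V' h) (W x) + B x (V x) (W' h))) (at x)"
proof -
  have V_deriv: "((\<lambda>y. B y (V y) w) has_derivative (\<lambda>h. D (\<lambda>y. B y (V x) w) x h + B x (V' h) w)) (at x)" for w
    using lin by (intro has_derivative_linear_family[where L="\<lambda>y v. B y v w", OF S _ B V]) (simp add: bilinear_def)
  have "((\<lambda>y. B y (V y) (W y)) has_derivative
      (\<lambda>h. D (\<lambda>y. B y (V y) (W x)) x h + B x (V x) (W' h))) (at x)"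
    using lin differentiableI[OF V_deriv]
    by (intro has_derivative_linear_family[where L="\<lambda>y. B y (V y)", OF S _ _ W]) (auto simp: bilinear_def)
  then show ?thesis by (simp add: D_eqI[OF V_deriv])
qed

text \<open>Since g vanishes at x, continuity of f at x replaces differentiability. This is what
  lets a solution known only to be continuous be shown differentiable.\<close>

lemma has_derivative_mult_vanishing:
  fixes f g :: "'a::real_normed_vector \<Rightarrow> real"
  assumes f: "isCont f x" and g: "(g has_derivative g') (at x)" and "g x = 0"
  shows "((\<lambda>y. f y * g y) has_derivative (\<lambda>h. f x * g' h)) (at x)"
proof -
  interpret g': bounded_linear g' using g by (rule has_derivative_bounded_linear)
  obtain K where K: "\<And>h. norm (g' h) \<le> norm h * K" using g'.bounded by blast
  have lim: "(\<lambda>h. norm (g (x + h) - g x - g' h) / norm h) \<midarrow>0\<rightarrow> 0"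
    using g by (simp add: has_derivative_at)
  have f0: "(\<lambda>h. f (x + h)) \<midarrow>0\<rightarrow> f x" using f by (simp add: isCont_iff)
  have "(\<lambda>h. \<bar>f (x + h)\<bar> * (norm (g (x + h) - g x - g' h) / norm h) + \<bar>f (x + h) - f x\<bar> * \<bar>K\<bar>)
      \<midarrow>0\<rightarrow> \<bar>f x\<bar> * 0 + \<bar>f x - f x\<bar> * \<bar>K\<bar>"
    by (intro tendsto_intros lim f0)
  then have "(\<lambda>h. norm (f (x + h) * g (x + h) - f x * g x - f x * g' h) / norm h) \<midarrow>0\<rightarrow> 0"
  proof (rule Lim_null_comparison[rotated, OF tendsto_eq_rhs], simp, intro always_eventually allI)
    fix h
    show "norm (norm (f (x + h) * g (x + h) - f x * g x - f x * g' h) / norm h)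
      \<le> \<bar>f (x + h)\<bar> * (norm (g (x + h) - g x - g' h) / norm h) + \<bar>f (x + h) - f x\<bar> * \<bar>K\<bar>"
    proof (cases "h = 0")
      case False
      \<comment> \<open>The first product is f times the remainder of g; the second is small by
        continuity of f against the linear bound on \<open>g'\<close>.\<close>
      have "f (x + h) * g (x + h) - f x * g x - f x * g' h
        = f (x + h) * (g (x + h) - g x - g' h) + (f (x + h) - f x) * g' h"
        using \<open>g x = 0\<close> by (simp add: algebra_simps)
      then have "\<bar>f (x + h) * g (x + h) - f x * g x - f x * g' h\<bar>
        \<le> \<bar>f (x + h)\<bar> * \<bar>g (x + h) - g x - g' h\<bar> + \<bar>f (x + h) - f x\<bar> * \<bar>g' h\<bar>"
        by (metis abs_mult abs_triangle_ineq)
      also have "\<dots> \<le> \<bar>f (x + h)\<bar> * \<bar>g (x + h) - g x - g' h\<bar> + \<bar>f (x + h) - f x\<bar> * (\<bar>K\<bar> * norm h)"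
      proof -
        have "\<bar>g' h\<bar> \<le> norm h * K" using K[of h] by simp
        also have "\<dots> \<le> \<bar>K\<bar> * norm h" by (simp add: mult.commute mult_right_mono)
        finally show ?thesis by (simp add: mult_left_mono)
      qed
      finally show ?thesis using False by (simp add: field_simps)
    qed simp
  qed
  then show ?thesis
    unfolding has_derivative_at using g'.bounded_linear_axioms bounded_linear_const_mult by blast
qed

text \<open>The inverse of the invertible matrix at \<open>x\<close> turns the system into a fixed point equation
  \<open>w y = P (k y) - P ((B y - B x) (w y))\<close>, which gives in turn boundedness, continuity and
  differentiability of \<open>w\<close> at \<open>x\<close>.\<close>

lemma differentiable_solution_of_linear_system:
  fixes B :: "'a::real_normed_vector \<Rightarrow> 'b::euclidean_space \<Rightarrow> 'b \<Rightarrow> real"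
  assumes S: "open S" "x \<in> S" and lin: "\<And>y. y \<in> S \<Longrightarrow> bilinear (B y)"
    and B: "\<And>v w. (\<lambda>y. B y v w) differentiable at x"
    and nondeg: "\<And>w. (\<And>z. B x w z = 0) \<Longrightarrow> w = 0"
    and k: "\<And>z. (\<lambda>y. k y z) differentiable at x"
    and w: "\<And>y z. y \<in> S \<Longrightarrow> B y (w y) z = k y z"
  shows "w differentiable at x"
proof -
  \<comment> \<open>The matrix of \<open>B x\<close>, as a map into coordinates; non-degeneracy
    makes it injective and supplies the left inverse \<open>P\<close>.\<close>
  define L where "L u = (\<Sum>b\<in>Basis. B x u b *\<^sub>R b)" for u
  have "linear L"
    using lin[OF S(2)] unfolding L_def linear_iff bilinear_def
    by (auto simp: scaleR_add_left sum.distrib scaleR_sum_right)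
  moreover have "inj L"
    unfolding linear_injective_0[OF \<open>linear L\<close>]
  proof (intro allI impI)
    fix u assume "L u = 0"
    then have *: "B x u b = 0" if "b \<in> Basis" for b
      using that inner_sum_left_Basis[OF that, of "\<lambda>b. B x u b"] by (simp add: L_def)
    have "linear (B x u)" using lin[OF S(2)] by (simp add: bilinear_def)
    then have "B x u z = 0" for z
      by (subst euclidean_representation[of z, symmetric]) (simp add: linear_sum linear_cmul *)
    then show "u = 0" using nondeg by blast
  qed
  ultimately obtain P where P: "linear P" "\<And>u. P (L u) = u"
    using linear_injective_left_inverse[of L] by (metis comp_apply id_apply)
  then have blP: "bounded_linear P" by (simp add: linear_conv_bounded_linear)
  \<comment> \<open>The perturbation of the matrix away from x. It tends to 0 entrywise and is
    exactly 0 at x.\<close>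
  define E where "E y c b = B y c b - B x c b" for y c b
  have E_deriv: "((\<lambda>y. E y c b) has_derivative D (\<lambda>y. B y c b) x) (at x)" for c b
    unfolding E_def by (auto intro!: derivative_eq_intros D_works B)
  have E_0: "(\<lambda>y. E y c b) \<midarrow>x\<rightarrow> 0" for c b
    using has_derivative_continuous[OF E_deriv[of c b]] by (simp add: continuous_at E_def)
  define rhs where "rhs y = (\<Sum>b\<in>Basis. (k y b - (\<Sum>c\<in>Basis. (w y \<bullet> c) * E y c b)) *\<^sub>R b)" for y
  have fixpoint: "w y = P (rhs y)" if y: "y \<in> S" for y
  proof -
    have "B x (w y) b = k y b - (\<Sum>c\<in>Basis. (w y \<bullet> c) * E y c b)" for b
    proof -
      have "B z (w y) b = (\<Sum>c\<in>Basis. (w y \<bullet> c) * B z c b)" if "z \<in> S" for z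
      proof -
        have l: "linear (\<lambda>v. B z v b)" using lin[OF that] by (simp add: bilinear_def)
        show ?thesis
          by (subst (1) euclidean_representation[of "w y", symmetric])
            (simp add: linear_sum[OF l] linear_cmul[OF l])
      qed
      from this[OF S(2)] this[OF y] show ?thesis
        using w[OF y, of b] by (simp add: E_def sum_subtractf algebra_simps)
    qed
    then have "L (w y) = rhs y" by (simp add: L_def rhs_def)
    then show ?thesis using P(2) by metis
  qed
  obtain K where K: "K > 0" "\<And>u. norm (P u) \<le> norm u * K"
    using bounded_linear.pos_bounded[OF blP] by blast
  define err where "err y = K * (\<Sum>b\<in>(Basis::'b set). \<Sum>c\<in>(Basis::'b set). \<bar>E y c b\<bar>)" for y
  have "err \<midarrow>x\<rightarrow> K * (\<Sum>b\<in>(Basis::'b set). \<Sum>c\<in>(Basis::'b set). \<bar>0\<bar>)"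
    unfolding err_def by (intro tendsto_intros E_0)
  then have err_0: "err \<midarrow>x\<rightarrow> 0" by simp
  have nS: "eventually (\<lambda>y. y \<in> S) (at x)" using S eventually_at_topological by blast
  define kb where "kb y = K * (\<Sum>b\<in>(Basis::'b set). \<bar>k y b\<bar>)" for y
  have kb_lim: "kb \<midarrow>x\<rightarrow> kb x"
    unfolding kb_def using differentiable_imp_continuous_within[OF k]
    by (intro tendsto_intros) (simp add: continuous_within)
  have bound: "norm (w y) \<le> kb y + norm (w y) * err y" if "y \<in> S" for y
  proof -
    have "norm (rhs y) \<le> (\<Sum>b\<in>Basis. \<bar>k y b - (\<Sum>c\<in>Basis. (w y \<bullet> c) * E y c b)\<bar>)"
      unfolding rhs_def by (rule norm_sum[THEN order_trans]) simp
    also have "\<dots> \<le> (\<Sum>b\<in>(Basis::'b set). \<bar>k y b\<bar> + norm (w y) * (\<Sum>c\<in>(Basis::'b set). \<bar>E y c b\<bar>))"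
    proof (rule sum_mono)
      fix b :: 'b
      have "\<bar>\<Sum>c\<in>Basis. (w y \<bullet> c) * E y c b\<bar> \<le> (\<Sum>c\<in>Basis. norm (w y) * \<bar>E y c b\<bar>)"
        by (rule sum_abs[THEN order_trans])
          (auto simp: abs_mult intro!: sum_mono mult_right_mono Basis_le_norm)
      then show "\<bar>k y b - (\<Sum>c\<in>Basis. (w y \<bullet> c) * E y c b)\<bar>
        \<le> \<bar>k y b\<bar> + norm (w y) * (\<Sum>c\<in>(Basis::'b set). \<bar>E y c b\<bar>)"
        by (simp add: sum_distrib_left)
    qed
    finally have "norm (rhs y) * K \<le> \<dots> * K" using K by simp
    moreover have "norm (w y) \<le> norm (rhs y) * K" using fixpoint[OF that] K(2) by metis
    ultimately show ?thesis
      by (simp add: err_def kb_def sum.distrib sum_distrib_left[symmetric] algebra_simps)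
  qed
  \<comment> \<open>Once \<open>err y < 1/2\<close>, half of \<open>norm (w y)\<close> is absorbed
    on the left of \<open>bound\<close>.\<close>
  have "eventually (\<lambda>y. norm (w y) \<le> 2 * (kb x + 1)) (at x)"
  proof -
    have "eventually (\<lambda>y. err y < 1/2) (at x)" using err_0 by (rule order_tendstoD) simp
    moreover have "eventually (\<lambda>y. kb y < kb x + 1) (at x)"
      using kb_lim by (rule order_tendstoD) simp
    ultimately show ?thesis using nS
    proof eventually_elim
      case (elim y)
      have "norm (w y) * err y \<le> norm (w y) * (1/2)" using elim by (intro mult_left_mono) auto
      with bound[of y] elim show ?case by simp
    qed
  qed
  then have Bf: "Bfun w (at x)" by (rule BfunI)
  have "(\<lambda>y. (w y \<bullet> c) * E y c b) \<midarrow>x\<rightarrow> 0" for c b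
  proof -
    have "Zfun (\<lambda>y. E y c b) (at x)" using E_0 by (simp add: tendsto_Zfun_iff)
    moreover have "Bfun (\<lambda>y. w y \<bullet> c) (at x)"
      using Bf unfolding Bfun_def
      by (elim exE conjE) (rule_tac x="K * (norm c + 1)" in exI,
         auto simp: mult_pos_pos add_nonneg_pos elim!: eventually_mono intro!: order_trans[OF Cauchy_Schwarz_ineq2] mult_mono)
    ultimately show ?thesis
      using bounded_bilinear.Bfun_prod_Zfun[OF bounded_bilinear_mult] by (simp add: tendsto_Zfun_iff)
  qed
  then have "rhs \<midarrow>x\<rightarrow> (\<Sum>b\<in>Basis. (k x b - (\<Sum>c\<in>(Basis::'b set). 0)) *\<^sub>R b)"
    unfolding rhs_def using differentiable_imp_continuous_within[OF k]
    by (intro tendsto_intros) (simp_all add: continuous_within)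
  moreover have "rhs x = (\<Sum>b\<in>Basis. (k x b - (\<Sum>c\<in>(Basis::'b set). 0)) *\<^sub>R b)"
    by (simp add: rhs_def E_def)
  ultimately have "(\<lambda>y. P (rhs y)) \<midarrow>x\<rightarrow> P (rhs x)"
    by (intro bounded_linear.tendsto[OF blP]) simp
  then have "w \<midarrow>x\<rightarrow> w x"
    by (rule Lim_transform_eventually[OF tendsto_eq_rhs])
      (use fixpoint S nS in \<open>auto elim!: eventually_mono\<close>)
  then have w_cont: "isCont (\<lambda>y. w y \<bullet> c) x" for c
    by (intro continuous_intros) (simp add: continuous_at)
  \<comment> \<open>The factor \<open>E y c b\<close> vanishes at x, so continuity of w is enough
    here; w is not yet known to be differentiable.\<close>
  have E_diff: "(\<lambda>y. (w y \<bullet> c) * E y c b) differentiable at x" for c b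
    using has_derivative_mult_vanishing[OF w_cont E_deriv] by (intro differentiableI) (simp add: E_def)
  have "rhs differentiable at x"
    unfolding rhs_def
    by (intro differentiable_sum ballI differentiable_scaleR differentiable_diff k E_diff differentiable_const finite_Basis)
  then have "(\<lambda>y. P (rhs y)) differentiable at x"
    unfolding differentiable_def using bounded_linear.has_derivative[OF blP] by blast
  then show ?thesis
    by (rule differentiable_cong_open[OF S, rotated]) (simp add: fixpoint)
qed

section \<open>Inner products\<close>

locale inner_form =
  fixes ip :: "'e::euclidean_space \<Rightarrow> 'e \<Rightarrow> real"
  assumes bil: "bilinear ip" and sym: "ip u v = ip v u" and pos: "u \<noteq> 0 \<Longrightarrow> ip u u > 0"
begin

lemma linear_left: "linear (\<lambda>u. ip u v)" and linear_right: "linear (ip u)"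
  using bil by (simp_all add: bilinear_def)

lemmas algebra =
  bilinear_ladd[OF bil] bilinear_radd[OF bil] bilinear_lsub[OF bil] bilinear_rsub[OF bil]
  bilinear_lmul[OF bil] bilinear_rmul[OF bil] bilinear_lneg[OF bil] bilinear_rneg[OF bil]
  bilinear_lzero[OF bil] bilinear_rzero[OF bil] linear_sum[OF linear_left] linear_sum[OF linear_right]

lemma nonneg: "ip u u \<ge> 0"
  using pos[of u] by (cases "u = 0") (simp_all add: algebra)

lemma eq_0_iff: "ip u u = 0 \<longleftrightarrow> u = 0"
  using pos[of u] by (cases "u = 0") (simp_all add: algebra)

lemma eqI:
  assumes "\<And>z. ip u z = ip v z"
  shows "u = v"
proof -
  have "ip (u - v) (u - v) = 0" using assms by (simp add: algebra)
  then show ?thesis by (simp add: eq_0_iff)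
qed

section \<open>Orthonormal bases, traces and representation of linear forms\<close>

text \<open>One Gram-Schmidt step, applied to a vector outside the span of the k <
  \<open>DIM('e)\<close> given ones.\<close>

lemma extend_orthonormal_system:
  assumes e: "\<And>i j. i < k \<Longrightarrow> j < k \<Longrightarrow> ip (e i) (e j) = (if i = j then 1 else 0)"
    and k: "k < DIM('e)"
  obtains v where "ip v v = 1" "\<And>i. i < k \<Longrightarrow> ip v (e i) = 0"
proof -
  have "dim (span (e ` {..<k})) \<le> card (e ` {..<k})" by (simp add: dim_le_card')
  also have "\<dots> \<le> k" using card_image_le[of "{..<k}" e] by simp
  finally have "span (e ` {..<k}) \<noteq> UNIV" using k by (metis dim_UNIV not_le)
  then obtain w where w: "w \<notin> span (e ` {..<k})" by auto
  define y where "y = w - (\<Sum>i<k. ip w (e i) *\<^sub>R e i)"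
  have "(\<Sum>i<k. ip w (e i) *\<^sub>R e i) \<in> span (e ` {..<k})"
    by (intro span_sum span_scale span_base) auto
  with w have "y \<noteq> 0" by (auto simp: y_def)
  have "ip y (e j) = 0" if "j < k" for j
  proof -
    have "(\<Sum>i<k. ip w (e i) * ip (e i) (e j)) = (\<Sum>i<k. if i = j then ip w (e i) else 0)"
      using e that by (intro sum.cong) auto
    then show ?thesis using that by (simp add: y_def algebra)
  qed
  moreover have "ip y y > 0" using \<open>y \<noteq> 0\<close> by (rule pos)
  ultimately show ?thesis
    by (intro that[of "(1 / sqrt (ip y y)) *\<^sub>R y"]) (auto simp: algebra)
qed

lemma ex_orthonormal_basis:
  assumes "ip u u = 1"
  obtains e where "orthonormal_basis ip e" "e 0 = u"
proof -
  have "\<exists>e. e 0 = u \<and> (\<forall>i<Suc k. \<forall>j<Suc k. ip (e i) (e j) = (if i = j then 1 else 0))"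
    if "k < DIM('e)" for k
    using that
  proof (induction k)
    case 0
    then show ?case using assms by (intro exI[of _ "\<lambda>_. u"]) simp
  next
    case (Suc k)
    then obtain e where e: "e 0 = u" "\<And>i j. i < Suc k \<Longrightarrow> j < Suc k \<Longrightarrow> ip (e i) (e j) = (if i = j then 1 else 0)"
      by auto
    obtain v where v: "ip v v = 1" "\<And>i. i < Suc k \<Longrightarrow> ip v (e i) = 0"
      using extend_orthonormal_system[OF e(2) Suc.prems] by blast
    show ?case
    proof (intro exI[of _ "e(Suc k := v)"] conjI allI impI)
      fix i j assume "i < Suc (Suc k)" "j < Suc (Suc k)"
      then consider "i = Suc k" "j = Suc k" | "i = Suc k" "j < Suc k" | "i < Suc k" "j = Suc k" | "i < Suc k" "j < Suc k"
        by linarith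
      then show "ip ((e(Suc k := v)) i) ((e(Suc k := v)) j) = (if i = j then 1 else 0)"
        using v e(2) sym[of "e i" v] by cases simp_all
    qed (simp add: e)
  qed
  \<comment> \<open>The induction covers indices below \<open>Suc k\<close>, and
    \<open>Suc (DIM('e) - 1) = DIM('e)\<close> because the dimension is positive.\<close>
  from this[of "DIM('e) - 1"] show ?thesis using that by (auto simp: orthonormal_basis_def)
qed

text \<open>The extension step applied to the empty system.\<close>

lemma ex_unit: obtains u where "ip u u = 1"
  by (rule extend_orthonormal_system[of 0 undefined]) auto

context
  fixes e assumes e: "orthonormal_basis ip e"
begin

lemma orthonormal: "i < DIM('e) \<Longrightarrow> j < DIM('e) \<Longrightarrow> ip (e i) (e j) = (if i = j then 1 else 0)"
  using e by (simp add: orthonormal_basis_def)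

text \<open>The residual is orthogonal to every \<open>e i\<close>. As these are
  \<open>DIM('e)\<close> independent vectors they span, so the residual is orthogonal to
  itself.\<close>

lemma expansion: "(\<Sum>i<DIM('e). ip v (e i) *\<^sub>R e i) = v"
proof (rule ccontr)
  let ?w = "v - (\<Sum>i<DIM('e). ip v (e i) *\<^sub>R e i)"
  have orth: "ip ?w (e j) = 0" if "j < DIM('e)" for j
  proof -
    have "(\<Sum>i<DIM('e). ip v (e i) * ip (e i) (e j)) = (\<Sum>i<DIM('e). if i = j then ip v (e i) else 0)"
      using orthonormal that by (intro sum.cong) auto
    then show ?thesis using that by (simp add: algebra)
  qed
  have inj: "inj_on e {..<DIM('e)}"
    using orthonormal by (intro inj_onI) (metis lessThan_iff zero_neq_one)
  have "independent (e ` {..<DIM('e)})"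
    unfolding independent_explicit_finite_subsets
  proof (intro allI impI ballI)
    fix A c a assume A: "A \<subseteq> e ` {..<DIM('e)}" "finite A" "(\<Sum>a\<in>A. c a *\<^sub>R a) = 0" "a \<in> A"
    then obtain i where i: "i < DIM('e)" "a = e i" by auto
    have "0 = ip (\<Sum>a\<in>A. c a *\<^sub>R a) a" using A by (simp add: algebra)
    also have "\<dots> = (\<Sum>b\<in>A. c b * ip b a)" by (simp add: algebra)
    also have "\<dots> = (\<Sum>b\<in>A. if b = a then c b else 0)"
    proof (rule sum.cong)
      fix b assume "b \<in> A"
      then obtain j where "j < DIM('e)" "b = e j" using A by auto
      then show "c b * ip b a = (if b = a then c b else 0)"
        using i orthonormal inj by (auto simp: inj_on_def)
    qed simp
    finally show "c a = 0" using A by simp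
  qed
  then have "span (e ` {..<DIM('e)}) = UNIV"
    using card_ge_dim_independent[of "e ` {..<DIM('e)}" UNIV] card_image[OF inj] by auto
  then have "?w \<in> span (e ` {..<DIM('e)})" by simp
  then have "ip ?w ?w = 0"
    by (rule linear_eq_0_on_span[OF linear_right, rotated]) (use orth in auto)
  then have "?w = 0" by (simp only: eq_0_iff)
  moreover assume "(\<Sum>i<DIM('e). ip v (e i) *\<^sub>R e i) \<noteq> v"
  ultimately show False by simp
qed

lemma linear_expansion:
  assumes "linear f"
  shows "f v = (\<Sum>i<DIM('e). ip v (e i) *\<^sub>R f (e i))"
proof -
  have "f (\<Sum>i<DIM('e). ip v (e i) *\<^sub>R e i) = (\<Sum>i<DIM('e). ip v (e i) *\<^sub>R f (e i))"
    by (simp add: linear_sum[OF assms] linear_cmul[OF assms])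
  then show ?thesis by (simp only: expansion)
qed

lemma parseval: "ip u v = (\<Sum>i<DIM('e). ip u (e i) * ip v (e i))"
proof -
  have "ip u v = (\<Sum>i<DIM('e). ip v (e i) *\<^sub>R ip u (e i))"
    by (rule linear_expansion[OF linear_right])
  then show ?thesis by (simp only: real_scaleR_def mult.commute)
qed

text \<open>\<open>endo_trace\<close> refers to the standard basis and the standard inner product of
  coordinate space, which are unrelated to \<open>ip\<close>. Expanding \<open>L b\<close> along
  \<open>e\<close> and exchanging the sums removes the standard basis.\<close>

lemma endo_trace_eq:
  assumes "linear L" shows "endo_trace L = (\<Sum>i<DIM('e). ip (L (e i)) (e i))"
proof -
  have "endo_trace L = (\<Sum>b\<in>Basis. \<Sum>i<DIM('e). ip (L b) (e i) * (e i \<bullet> b))"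
    unfolding endo_trace_def
  proof (intro sum.cong refl)
    fix b :: 'e
    have "(\<Sum>i<DIM('e). ip (L b) (e i) *\<^sub>R e i) \<bullet> b = (\<Sum>i<DIM('e). ip (L b) (e i) * (e i \<bullet> b))"
      by (simp add: inner_sum_left)
    then show "L b \<bullet> b = (\<Sum>i<DIM('e). ip (L b) (e i) * (e i \<bullet> b))" by (simp only: expansion)
  qed
  also have "\<dots> = (\<Sum>i<DIM('e). ip (\<Sum>b\<in>Basis. (e i \<bullet> b) *\<^sub>R L b) (e i))"
    by (subst sum.swap) (simp add: algebra mult.commute)
  also have "\<dots> = (\<Sum>i<DIM('e). ip (L (e i)) (e i))"
  proof -
    have "(\<Sum>b\<in>Basis. (v \<bullet> b) *\<^sub>R L b) = L v" for v
    proof -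
      have "L (\<Sum>b\<in>Basis. (v \<bullet> b) *\<^sub>R b) = (\<Sum>b\<in>Basis. (v \<bullet> b) *\<^sub>R L b)"
        by (simp add: linear_sum[OF assms] linear_cmul[OF assms])
      then show ?thesis by (simp only: euclidean_representation)
    qed
    then show ?thesis by simp
  qed
  finally show ?thesis .
qed

end

text \<open>Frees \<open>mean_curvature\<close> from its chosen basis. After expanding each
  \<open>e i\<close> along \<open>f\<close>, Parseval over \<open>e\<close> collapses the
  coefficients to the inner products of the \<open>f j\<close>.\<close>

lemma trace_independent:
  fixes s :: "'e \<Rightarrow> 'e \<Rightarrow> 'f::real_vector"
  assumes e: "orthonormal_basis ip e" and f: "orthonormal_basis ip f" and s: "bilinear s"
  shows "(\<Sum>i<DIM('e). s (e i) (e i)) = (\<Sum>i<DIM('e). s (f i) (f i))"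
proof -
  have lin: "linear (s u)" "linear (\<lambda>v. s v u)" for u using s by (simp_all add: bilinear_def)
  have "(\<Sum>i<DIM('e). s (e i) (e i))
      = (\<Sum>i<DIM('e). \<Sum>j<DIM('e). \<Sum>k<DIM('e). (ip (e i) (f k) * ip (e i) (f j)) *\<^sub>R s (f j) (f k))"
  proof (intro sum.cong refl)
    fix i
    have "s (e i) (e i) = (\<Sum>j<DIM('e). ip (e i) (f j) *\<^sub>R s (f j) (e i))"
      by (rule linear_expansion[OF f lin(2)])
    also have "\<dots> = (\<Sum>j<DIM('e). ip (e i) (f j) *\<^sub>R (\<Sum>k<DIM('e). ip (e i) (f k) *\<^sub>R s (f j) (f k)))"
      by (intro sum.cong refl arg_cong[of _ _ "scaleR _"] linear_expansion[OF f lin(1)])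
    finally show "s (e i) (e i)
      = (\<Sum>j<DIM('e). \<Sum>k<DIM('e). (ip (e i) (f k) * ip (e i) (f j)) *\<^sub>R s (f j) (f k))"
      by (simp add: scaleR_sum_right mult.commute)
  qed
  also have "\<dots> = (\<Sum>j<DIM('e). \<Sum>k<DIM('e). \<Sum>i<DIM('e). (ip (e i) (f k) * ip (e i) (f j)) *\<^sub>R s (f j) (f k))"
    by (subst sum.swap) (intro sum.cong refl sum.swap)
  also have "\<dots> = (\<Sum>j<DIM('e). \<Sum>k<DIM('e). ip (f k) (f j) *\<^sub>R s (f j) (f k))"
    by (simp only: parseval[OF e, of "f _" "f _"] sym[of "e _" "f _"] scaleR_sum_left)
  also have "\<dots> = (\<Sum>j<DIM('e). \<Sum>k<DIM('e). if k = j then s (f j) (f k) else 0)"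
    by (intro sum.cong refl) (simp add: orthonormal[OF f])
  finally show ?thesis by simp
qed

text \<open>Riesz representation; it gives meaning to the definite descriptions in
  \<open>christoffel\<close> and \<open>tangential\<close>.\<close>

lemma ex1_representation:
  assumes "linear f" shows "\<exists>!w. \<forall>z. ip w z = f z"
proof -
  obtain u where "ip u u = 1" by (rule ex_unit)
  then obtain e where e: "orthonormal_basis ip e" by (rule ex_orthonormal_basis)
  show ?thesis
  proof (rule ex1I[of _ "\<Sum>i<DIM('e). f (e i) *\<^sub>R e i"])
    show "\<forall>z. ip (\<Sum>i<DIM('e). f (e i) *\<^sub>R e i) z = f z"
    proof
      fix z
      have "f z = (\<Sum>i<DIM('e). ip z (e i) *\<^sub>R f (e i))" by (rule linear_expansion[OF e assms])
      then show "ip (\<Sum>i<DIM('e). f (e i) *\<^sub>R e i) z = f z"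
        by (simp add: algebra sym[of "e _" z] mult.commute)
    qed
  next
    fix w assume "\<forall>z. ip w z = f z"
    then show "w = (\<Sum>i<DIM('e). f (e i) *\<^sub>R e i)"
      using expansion[OF e, of w] by simp
  qed
qed

end

section \<open>Pointwise algebra of the Ricci inequality and its equality cases\<close>

text \<open>Pointwise data of a submanifold: \<open>ip\<close> is the induced metric, \<open>G\<close> the ambient one and \<open>s\<close>
  the second fundamental form.\<close>

locale normal_valued_form = inner_form ip + G: inner_form G
  for ip :: "'d::euclidean_space \<Rightarrow> 'd \<Rightarrow> real" and G :: "'e::euclidean_space \<Rightarrow> 'e \<Rightarrow> real" +
  fixes s :: "'d \<Rightarrow> 'd \<Rightarrow> 'e" and H :: 'e
  assumes s_bil: "bilinear s" and s_sym: "s u v = s v u"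
    and H: "\<And>e. orthonormal_basis ip e \<Longrightarrow> (\<Sum>i<DIM('d). s (e i) (e i)) = real DIM('d) *\<^sub>R H"
begin

lemma s_linear: "linear (s u)"
  using s_bil by (simp add: bilinear_def)

text \<open>What the second fundamental form contributes, through the Gauss equation, to the Ricci
  curvature in direction \<open>e 0\<close>.\<close>

definition gauss_sum :: "(nat \<Rightarrow> 'd) \<Rightarrow> real" where
  "gauss_sum e = (\<Sum>j=1..<DIM('d). G (s (e 0) (e 0)) (s (e j) (e j)) - G (s (e 0) (e j)) (s (e 0) (e j)))"

lemma gauss_sum_eq:
  assumes e: "orthonormal_basis ip e"
  shows "1 / 4 * real DIM('d) ^ 2 * G H H - gauss_sum e =
    1 / 4 * G (2 *\<^sub>R s (e 0) (e 0) - real DIM('d) *\<^sub>R H) (2 *\<^sub>R s (e 0) (e 0) - real DIM('d) *\<^sub>R H)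
    + (\<Sum>j=1..<DIM('d). G (s (e 0) (e j)) (s (e 0) (e j)))"
proof -
  have "real DIM('d) *\<^sub>R H = s (e 0) (e 0) + (\<Sum>j=1..<DIM('d). s (e j) (e j))"
    unfolding H[OF e, symmetric] lessThan_atLeast0
    by (subst sum.atLeast_Suc_lessThan) simp_all
  then have rest: "(\<Sum>j=1..<DIM('d). s (e j) (e j)) = real DIM('d) *\<^sub>R H - s (e 0) (e 0)" by simp
  have "gauss_sum e = G (s (e 0) (e 0)) (\<Sum>j=1..<DIM('d). s (e j) (e j))
      - (\<Sum>j=1..<DIM('d). G (s (e 0) (e j)) (s (e 0) (e j)))"
    by (simp add: gauss_sum_def sum_subtractf G.algebra)
  \<comment> \<open>Completing the square: with a = s(e 0, e 0) the other diagonal values add up to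
    N H - a. This is the origin of the constant 1 / 4.\<close>
  moreover have "1 / 4 * N\<^sup>2 * G H H - G a (N *\<^sub>R H - a) = 1 / 4 * G (2 *\<^sub>R a - N *\<^sub>R H) (2 *\<^sub>R a - N *\<^sub>R H)" for N a
    by (simp add: G.algebra G.sym[of H a] power2_eq_square field_simps)
  ultimately show ?thesis unfolding rest by simp
qed

lemma gauss_sum_le:
  assumes "orthonormal_basis ip e"
  shows "gauss_sum e \<le> 1 / 4 * real DIM('d) ^ 2 * G H H"
proof -
  have "0 \<le> 1 / 4 * real DIM('d) ^ 2 * G H H - gauss_sum e"
    unfolding gauss_sum_eq[OF assms]
    by (intro add_nonneg_nonneg sum_nonneg mult_nonneg_nonneg G.nonneg) simp
  then show ?thesis by simp
qed

lemma gauss_sum_eq_iff: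
  assumes e: "orthonormal_basis ip e"
  shows "gauss_sum e = 1 / 4 * real DIM('d) ^ 2 * G H H \<longleftrightarrow>
    2 *\<^sub>R s (e 0) (e 0) = real DIM('d) *\<^sub>R H \<and> (\<forall>j\<in>{1..<DIM('d)}. s (e 0) (e j) = 0)"
proof -
  have "gauss_sum e = 1 / 4 * real DIM('d) ^ 2 * G H H \<longleftrightarrow>
      1 / 4 * real DIM('d) ^ 2 * G H H - gauss_sum e = 0" by auto
  also have "\<dots> \<longleftrightarrow> 2 *\<^sub>R s (e 0) (e 0) = real DIM('d) *\<^sub>R H \<and> (\<forall>j\<in>{1..<DIM('d)}. s (e 0) (e j) = 0)"
    unfolding gauss_sum_eq[OF e]
    by (subst add_nonneg_eq_0_iff)
      (auto simp: sum_nonneg_eq_0_iff G.nonneg G.eq_0_iff intro: sum_nonneg)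
  finally show ?thesis .
qed

text \<open>For H = 0 the two equality conditions together say that s(e 0, e j) = 0 for all j, the
  index 0 included; linearity does the rest.\<close>

lemma equality_iff_relative_null:
  assumes e: "orthonormal_basis ip e" and "H = 0"
  shows "gauss_sum e = 1 / 4 * real DIM('d) ^ 2 * G H H \<longleftrightarrow> (\<forall>v. s (e 0) v = 0)"
proof
  assume "gauss_sum e = 1 / 4 * real DIM('d) ^ 2 * G H H"
  then have *: "s (e 0) (e 0) = 0" "\<forall>j\<in>{1..<DIM('d)}. s (e 0) (e j) = 0"
    unfolding gauss_sum_eq_iff[OF e] using \<open>H = 0\<close> by auto
  have "s (e 0) (e j) = 0" if "j < DIM('d)" for j
    using * that by (cases "j = 0") auto
  then show "\<forall>v. s (e 0) v = 0" by (subst linear_expansion[OF e s_linear]) simp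
qed (unfold gauss_sum_eq_iff[OF e], simp add: \<open>H = 0\<close>)

text \<open>The diagonal condition holds at every unit vector, in particular at every member of one
  basis \<open>e u\<close>; summing there forces H = 0 because n (2 - n) is nonzero. Then s(v, v) =
  0 by normalizing v, and polarization recovers the remaining values.\<close>

lemma equality_everywhere_iff:
  assumes "DIM('d) \<noteq> 2"
    and e: "\<And>u. ip u u = 1 \<Longrightarrow> orthonormal_basis ip (e u) \<and> e u 0 = u"
  shows "(\<forall>u. ip u u = 1 \<longrightarrow> gauss_sum (e u) = 1 / 4 * real DIM('d) ^ 2 * G H H) \<longleftrightarrow> (\<forall>u v. s u v = 0)"
proof
  assume "\<forall>u v. s u v = 0"
  moreover obtain u where "ip u u = 1" by (rule ex_unit)
  ultimately have "H = 0" using H[of "e u"] e[of u] by simp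
  note \<open>\<forall>u v. s u v = 0\<close> \<open>H = 0\<close>
  then show "\<forall>u. ip u u = 1 \<longrightarrow> gauss_sum (e u) = 1 / 4 * real DIM('d) ^ 2 * G H H"
    by (simp add: gauss_sum_def G.algebra)
next
  assume eq: "\<forall>u. ip u u = 1 \<longrightarrow> gauss_sum (e u) = 1 / 4 * real DIM('d) ^ 2 * G H H"
  have unit: "2 *\<^sub>R s u u = real DIM('d) *\<^sub>R H" if "ip u u = 1" for u
    using eq that e[OF that] gauss_sum_eq_iff[of "e u"] by auto
  obtain u where u: "ip u u = 1" by (rule ex_unit)
  then have eu: "orthonormal_basis ip (e u)" using e by blast
  have "2 *\<^sub>R (real DIM('d) *\<^sub>R H) = (\<Sum>i<DIM('d). 2 *\<^sub>R s (e u i) (e u i))"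
    by (simp add: H[OF eu, symmetric] scaleR_sum_right)
  also have "\<dots> = (\<Sum>i<DIM('d). real DIM('d) *\<^sub>R H)"
    using orthonormal[OF eu] by (intro sum.cong unit) auto
  finally have "(2 * real DIM('d) - real DIM('d) * real DIM('d)) *\<^sub>R H = 0"
    by (simp add: scaleR_diff_left sum_constant_scaleR)
  moreover have "2 * real DIM('d) - real DIM('d) * real DIM('d) \<noteq> 0"
  proof -
    have "2 * real DIM('d) - real DIM('d) * real DIM('d) = real DIM('d) * (2 - real DIM('d))"
      by (simp add: algebra_simps)
    then show ?thesis using assms(1) by simp
  qed
  ultimately have "H = 0" by simp
  have diag: "s v v = 0" for v
  proof (cases "v = 0")
    case False
    then have "ip v v > 0" by (rule pos)
    then have "2 *\<^sub>R s ((1 / sqrt (ip v v)) *\<^sub>R v) ((1 / sqrt (ip v v)) *\<^sub>R v) = real DIM('d) *\<^sub>R H"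
      by (intro unit) (simp add: algebra)
    with \<open>H = 0\<close> \<open>ip v v > 0\<close> show ?thesis
      by (simp add: bilinear_lmul[OF s_bil] bilinear_rmul[OF s_bil])
  qed (simp add: bilinear_lzero[OF s_bil])
  show "\<forall>u v. s u v = 0"
  proof (intro allI)
    fix u v
    have "s (u + v) (u + v) = s u u + s v v + 2 *\<^sub>R s u v"
      by (simp add: bilinear_ladd[OF s_bil] bilinear_radd[OF s_bil] s_sym[of v u] scaleR_2)
    then show "s u v = 0" using diag by simp
  qed
qed

end

section \<open>The Gauss equation in coordinates\<close>

lemma linear_D_family:
  fixes L :: "'a::real_normed_vector \<Rightarrow> 'b::real_vector \<Rightarrow> 'c::real_normed_vector"
  assumes S: "open S" "x \<in> S" and lin: "\<And>y. y \<in> S \<Longrightarrow> linear (L y)"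
    and L: "\<And>w. (\<lambda>y. L y w) differentiable at x"
  shows "linear (\<lambda>w. D (\<lambda>y. L y w) x h)"
proof (rule linearI)
  fix v w
  have "((\<lambda>y. L y v + L y w) has_derivative (\<lambda>h. D (\<lambda>y. L y v) x h + D (\<lambda>y. L y w) x h)) (at x)"
    by (intro has_derivative_add D_works L)
  then have "((\<lambda>y. L y (v + w)) has_derivative (\<lambda>h. D (\<lambda>y. L y v) x h + D (\<lambda>y. L y w) x h)) (at x)"
    by (rule has_derivative_transform_within_open[OF _ S]) (simp add: linear_add[OF lin])
  then show "D (\<lambda>y. L y (v + w)) x h = D (\<lambda>y. L y v) x h + D (\<lambda>y. L y w) x h"
    by (simp add: D_eqI)
next
  fix c v
  have "((\<lambda>y. c *\<^sub>R L y v) has_derivative (\<lambda>h. c *\<^sub>R D (\<lambda>y. L y v) x h)) (at x)"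
    by (intro has_derivative_scaleR_right D_works L)
  then have "((\<lambda>y. L y (c *\<^sub>R v)) has_derivative (\<lambda>h. c *\<^sub>R D (\<lambda>y. L y v) x h)) (at x)"
    by (rule has_derivative_transform_within_open[OF _ S]) (simp add: linear_cmul[OF lin])
  then show "D (\<lambda>y. L y (c *\<^sub>R v)) x h = c *\<^sub>R D (\<lambda>y. L y v) x h"
    by (simp add: D_eqI)
qed

section \<open>The Levi-Civita connection of a metric in one chart\<close>

text \<open>The regularity is just enough for Christoffel vectors to be differentiable, hence for
  curvature; it is kept this low so that the induced metric can be shown to satisfy it.\<close>

locale metric_patch =
  fixes S :: "'e::euclidean_space set" and G :: "'e \<Rightarrow> 'e \<Rightarrow> 'e \<Rightarrow> real"
  assumes open_S: "open S"
    and inner: "x \<in> S \<Longrightarrow> inner_form (G x)"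
    and G_diff: "x \<in> S \<Longrightarrow> (\<lambda>y. G y u v) differentiable at x"
    and G_diff2: "x \<in> S \<Longrightarrow> (\<lambda>y. D (\<lambda>y. G y u v) y w) differentiable at x"
begin

definition koszul :: "'e \<Rightarrow> 'e \<Rightarrow> 'e \<Rightarrow> 'e \<Rightarrow> real" where
  "koszul x u v z = (D (\<lambda>y. G y v z) x u + D (\<lambda>y. G y u z) x v - D (\<lambda>y. G y u v) x z) / 2"

lemma D_sym: "x \<in> S \<Longrightarrow> D (\<lambda>y. G y u v) x w = D (\<lambda>y. G y v u) x w"
  by (rule fun_cong[OF D_cong_open[OF open_S _ inner_form.sym[OF inner] G_diff]])

lemma koszul_sym: "x \<in> S \<Longrightarrow> koszul x u v z = koszul x v u z"
  by (simp add: koszul_def D_sym[of x u v])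

lemma linear_D:
  assumes x: "x \<in> S"
  shows "linear (D (\<lambda>y. G y u v) x)" "linear (\<lambda>u. D (\<lambda>y. G y u v) x w)" "linear (\<lambda>v. D (\<lambda>y. G y u v) x w)"
proof -
  show "linear (D (\<lambda>y. G y u v) x)" by (rule linear_frechet_derivative[OF G_diff[OF x]])
  show "linear (\<lambda>u. D (\<lambda>y. G y u v) x w)"
    by (rule linear_D_family[OF open_S x, of "\<lambda>y u. G y u v"])
      (auto intro: inner_form.linear_left inner G_diff[OF x])
  show "linear (\<lambda>v. D (\<lambda>y. G y u v) x w)"
    by (rule linear_D_family[OF open_S x, of "\<lambda>y. G y u"])
      (auto intro: inner_form.linear_right inner G_diff[OF x])
qed

lemma koszul_linear:
  assumes x: "x \<in> S"
  shows "linear (koszul x u v)" "linear (\<lambda>u. koszul x u v z)"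
proof -
  have koszul_scaleR: "koszul x u v z = (1 / 2) *\<^sub>R (D (\<lambda>y. G y v z) x u + D (\<lambda>y. G y u z) x v - D (\<lambda>y. G y u v) x z)"
    for u v z by (simp add: koszul_def)
  show "linear (koszul x u v)" "linear (\<lambda>u. koszul x u v z)"
    unfolding koszul_scaleR
    by (intro linear_compose_scale_right linear_compose_sub linear_compose_add linear_D[OF x])+
qed

lemma christoffel:
  assumes x: "x \<in> S" shows "G x (christoffel G x u v) z = koszul x u v z"
proof -
  have "\<forall>z. G x (christoffel G x u v) z = koszul x u v z"
    unfolding christoffel_def koszul_def[symmetric]
    by (rule theI'[OF inner_form.ex1_representation[OF inner[OF x] koszul_linear(1)[OF x]]])
  then show ?thesis ..
qed

lemma christoffel_eqI:
  assumes "x \<in> S" "\<And>z. G x w z = koszul x u v z" shows "christoffel G x u v = w"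
  by (rule inner_form.eqI[OF inner[OF assms(1)]]) (simp only: christoffel[OF assms(1)] assms(2))

lemma christoffel_sym: "x \<in> S \<Longrightarrow> christoffel G x u v = christoffel G x v u"
  by (rule christoffel_eqI) (simp_all add: christoffel koszul_sym[of x u v])

lemma bilinear_christoffel:
  assumes x: "x \<in> S" shows "bilinear (christoffel G x)"
proof -
  interpret inner_form "G x" by (rule inner[OF x])
  have l: "linear (\<lambda>u. christoffel G x u v)" for v
  proof (rule linearI)
    fix a b c
    show "christoffel G x (a + b) v = christoffel G x a v + christoffel G x b v"
      by (rule christoffel_eqI[OF x])
        (simp add: algebra(1) christoffel[OF x] linear_add[OF koszul_linear(2)[OF x]])
    show "christoffel G x (c *\<^sub>R a) v = c *\<^sub>R christoffel G x a v"
      by (rule christoffel_eqI[OF x])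
        (simp add: algebra(5) christoffel[OF x] linear_cmul[OF koszul_linear(2)[OF x]])
  qed
  have "christoffel G x u = (\<lambda>v. christoffel G x v u)" for u
    using christoffel_sym[OF x] by blast
  with l show ?thesis unfolding bilinear_def by metis
qed

text \<open>Adding the Koszul expressions for (u, v, z) and (u, z, v) cancels everything but the
  derivative along u.\<close>

lemma metric_compatible:
  assumes x: "x \<in> S"
  shows "D (\<lambda>y. G y v z) x u = G x (christoffel G x u v) z + G x v (christoffel G x u z)"
proof -
  have "G x v (christoffel G x u z) = koszul x u z v"
    using inner_form.sym[OF inner[OF x]] christoffel[OF x] by metis
  then show ?thesis
    by (simp add: christoffel[OF x] koszul_def D_sym[OF x, of z v] D_sym[OF x, of u v] D_sym[OF x, of u z] field_simps)
qed

text \<open>The Christoffel vector solves the linear system with matrix \<open>G y\<close> and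
  right-hand side \<open>koszul y u v\<close>.\<close>

lemma christoffel_differentiable:
  assumes x: "x \<in> S" shows "(\<lambda>y. christoffel G y u v) differentiable at x"
proof (rule differentiable_solution_of_linear_system[OF open_S x])
  show "bilinear (G y)" if "y \<in> S" for y using inner_form.bil[OF inner[OF that]] .
  show "(\<lambda>y. G y v w) differentiable at x" for v w by (rule G_diff[OF x])
  show "w = 0" if "\<And>z. G x w z = 0" for w
    using that inner_form.eq_0_iff[OF inner[OF x]] by blast
  show "(\<lambda>y. koszul y u v z) differentiable at x" for z
    unfolding koszul_def divide_inverse
    by (intro differentiable_mult differentiable_diff differentiable_add G_diff2[OF x] differentiable_const)
  show "G y (christoffel G y u v) z = koszul y u v z" if "y \<in> S" for y z
    by (rule christoffel[OF that])
qed

lemma curvature_eq: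
  assumes x: "x \<in> S"
  shows "curvature G x u v w =
    D (\<lambda>y. christoffel G y v w) x u + christoffel G x u (christoffel G x v w)
    - (D (\<lambda>y. christoffel G y u w) x v + christoffel G x v (christoffel G x u w))"
proof -
  \<comment> \<open>The bracket of constant fields is 0, so the third term of the curvature reduces
    to this one.\<close>
  have "christoffel G x 0 w = 0" using bilinear_lzero[OF bilinear_christoffel[OF x]] .
  then show ?thesis
    by (simp add: curvature_def nabla_def[abs_def] lie_bracket_def Let_def)
qed

end

section \<open>Immersions, the Gauss formula and the Gauss equation\<close>

locale immersed_patch = U: metric_patch U G
  for U :: "'e::euclidean_space set" and G +
  fixes S :: "'d::euclidean_space set" and F :: "'d \<Rightarrow> 'e"
  assumes open_dom: "open S" and F_smooth: "smooth_on S F"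
    and F_in: "x \<in> S \<Longrightarrow> F x \<in> U" and F_inj: "x \<in> S \<Longrightarrow> inj (D F x)"
begin

abbreviation J where "J \<equiv> push F"
abbreviation \<gamma> where "\<gamma> \<equiv> induced_metric G F"
abbreviation N where "N \<equiv> ambient_nabla G F"
text \<open>The second derivative of the inclusion map along \<open>u\<close> and
  \<open>v\<close>.\<close>

abbreviation hess where "hess x u v \<equiv> D (\<lambda>y. J y v) x u"

lemma F_deriv: "x \<in> S \<Longrightarrow> (F has_derivative J x) (at x)"
  unfolding push_def by (rule D_works[OF smooth_on_differentiable[OF F_smooth]])

lemma linear_J: "x \<in> S \<Longrightarrow> linear (J x)"
  using F_deriv has_derivative_linear by blast

lemma J_eq_0_iff: "x \<in> S \<Longrightarrow> J x u = 0 \<longleftrightarrow> u = 0"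
  using F_inj[of x] linear_J[of x] linear_injective_0[of "J x"]
  by (auto simp: push_def[abs_def] linear_0)

lemma J_smooth: "smooth_on S (\<lambda>y. J y v)"
  unfolding push_def by (rule smooth_on_D[OF F_smooth])

lemma J_deriv: "x \<in> S \<Longrightarrow> ((\<lambda>y. J y v) has_derivative (\<lambda>u. hess x u v)) (at x)"
  by (rule D_works[OF smooth_on_differentiable[OF J_smooth]])

lemma hess_sym: "x \<in> S \<Longrightarrow> hess x u v = hess x v u"
  unfolding push_def by (rule D_commute[OF open_dom _ F_smooth])

text \<open>Symmetry of the third derivatives of F, which must cancel in the Gauss equation.\<close>

lemma hess_D_sym: "x \<in> S \<Longrightarrow> D (\<lambda>y. hess y u w) x v = D (\<lambda>y. hess y v w) x u"
  by (rule D_commute[OF open_dom _ J_smooth])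

lemma linear_hess: "x \<in> S \<Longrightarrow> linear (\<lambda>u. hess x u v)"
  using J_deriv has_derivative_linear by blast

lemma N_eq: "N x u v = hess x u v + christoffel G (F x) (J x u) (J x v)"
  by (simp add: ambient_nabla_def)

lemma N_sym: "x \<in> S \<Longrightarrow> N x u v = N x v u"
  by (simp add: N_eq hess_sym[of x u] U.christoffel_sym[OF F_in, of x "J x u"])

lemma N_bilinear: "x \<in> S \<Longrightarrow> bilinear (N x)"
proof -
  assume x: "x \<in> S"
  note b = U.bilinear_christoffel[OF F_in[OF x]]
  have l: "linear (\<lambda>u. N x u v)" for v
    unfolding N_eq
    by (rule linearI) (simp_all add: linear_add[OF linear_hess[OF x]] linear_cmul[OF linear_hess[OF x]]
        linear_add[OF linear_J[OF x]] linear_cmul[OF linear_J[OF x]] bilinear_ladd[OF b] bilinear_lmul[OF b] algebra_simps)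
  have "N x u = (\<lambda>v. N x v u)" for u using N_sym[OF x] by blast
  with l show ?thesis unfolding bilinear_def by metis
qed

lemma comp_differentiable:
  assumes x: "x \<in> S" and f: "f differentiable at (F x)"
  shows "(\<lambda>y. f (F y)) differentiable at x" and "D (\<lambda>y. f (F y)) x u = D f (F x) (J x u)"
proof -
  have "((\<lambda>y. f (F y)) has_derivative (\<lambda>u. D f (F x) (J x u))) (at x)"
    by (rule has_derivative_compose[OF F_deriv[OF x] D_works[OF f]])
  then show "(\<lambda>y. f (F y)) differentiable at x" "D (\<lambda>y. f (F y)) x u = D f (F x) (J x u)"
    by (auto intro: differentiableI simp: D_eqI)
qed

text \<open>The covariant Leibniz rule for fields along F: metric compatibility converts the change
  of the base point into the two Christoffel terms.\<close>

lemma metric_along: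
  assumes x: "x \<in> S" and V: "(V has_derivative V') (at x)" and W: "(W has_derivative W') (at x)"
  shows "((\<lambda>y. G (F y) (V y) (W y)) has_derivative
    (\<lambda>u. G (F x) (V' u + christoffel G (F x) (J x u) (V x)) (W x)
       + G (F x) (V x) (W' u + christoffel G (F x) (J x u) (W x)))) (at x)"
proof (rule has_derivative_eq_rhs)
  interpret i: inner_form "G (F x)" by (rule U.inner[OF F_in[OF x]])
  show "((\<lambda>y. G (F y) (V y) (W y)) has_derivative
    (\<lambda>u. D (\<lambda>y. G (F y) (V x) (W x)) x u + G (F x) (V' u) (W x) + G (F x) (V x) (W' u))) (at x)"
    by (rule has_derivative_bilinear_family[OF open_dom x _ _ V W])
      (auto intro!: inner_form.bil U.inner F_in comp_differentiable x U.G_diff)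
  show "(\<lambda>u. D (\<lambda>y. G (F y) (V x) (W x)) x u + G (F x) (V' u) (W x) + G (F x) (V x) (W' u))
    = (\<lambda>u. G (F x) (V' u + christoffel G (F x) (J x u) (V x)) (W x)
       + G (F x) (V x) (W' u + christoffel G (F x) (J x u) (W x)))"
    by (simp add: comp_differentiable(2)[OF x U.G_diff[OF F_in[OF x]]] i.algebra
        U.metric_compatible[OF F_in[OF x]] add_ac)
qed

lemma christoffel_along:
  assumes x: "x \<in> S" and V: "(V has_derivative V') (at x)" and W: "(W has_derivative W') (at x)"
  shows "((\<lambda>y. christoffel G (F y) (V y) (W y)) has_derivative
    (\<lambda>u. D (\<lambda>z. christoffel G z (V x) (W x)) (F x) (J x u) + christoffel G (F x) (V' u) (W x)
       + christoffel G (F x) (V x) (W' u))) (at x)"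
proof (rule has_derivative_eq_rhs)
  show "((\<lambda>y. christoffel G (F y) (V y) (W y)) has_derivative
    (\<lambda>u. D (\<lambda>y. christoffel G (F y) (V x) (W x)) x u + christoffel G (F x) (V' u) (W x)
       + christoffel G (F x) (V x) (W' u))) (at x)"
    by (rule has_derivative_bilinear_family[OF open_dom x _ _ V W])
      (auto intro!: U.bilinear_christoffel F_in comp_differentiable x U.christoffel_differentiable)
qed (simp add: comp_differentiable(2)[OF x U.christoffel_differentiable[OF F_in[OF x]]])

lemma N_deriv:
  assumes x: "x \<in> S"
  shows "((\<lambda>y. N y v w) has_derivative
    (\<lambda>u. D (\<lambda>y. hess y v w) x u + (D (\<lambda>z. christoffel G z (J x v) (J x w)) (F x) (J x u)
      + christoffel G (F x) (hess x u v) (J x w) + christoffel G (F x) (J x v) (hess x u w)))) (at x)"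
  unfolding N_eq
  by (intro has_derivative_add christoffel_along J_deriv x
      D_works[OF smooth_on_differentiable[OF smooth_on_D[OF J_smooth] x]])

lemma induced_deriv:
  assumes x: "x \<in> S"
  shows "((\<lambda>y. \<gamma> y v w) has_derivative
    (\<lambda>u. G (F x) (N x u v) (J x w) + G (F x) (J x v) (N x u w))) (at x)"
  unfolding induced_metric_def N_eq by (intro metric_along J_deriv x)

lemma induced_inner:
  assumes x: "x \<in> S" shows "inner_form (\<gamma> x)"
proof -
  interpret i: inner_form "G (F x)" by (rule U.inner[OF F_in[OF x]])
  show ?thesis
  proof
    show "bilinear (\<gamma> x)"
      unfolding bilinear_def induced_metric_def
      by (auto intro!: linearI simp: linear_add[OF linear_J[OF x]] linear_cmul[OF linear_J[OF x]] i.algebra)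
  qed (simp_all add: induced_metric_def J_eq_0_iff[OF x] i.pos i.sym[of "J x _" "J x _"])
qed

text \<open>The first derivative of the induced metric is an expression in \<open>N\<close> and
  \<open>J\<close>, both differentiable, so it can be differentiated once more by
  \<open>metric_along\<close>.\<close>

lemma induced_deriv_differentiable:
  assumes x: "x \<in> S" shows "(\<lambda>y. D (\<lambda>y. \<gamma> y v w) y u) differentiable at x"
proof (rule differentiable_cong_open[OF open_dom x])
  fix y assume "y \<in> S"
  then show "G (F y) (N y u v) (J y w) + G (F y) (J y v) (N y u w) = D (\<lambda>y. \<gamma> y v w) y u"
    by (simp only: D_eqI[OF induced_deriv])
next
  show "(\<lambda>y. G (F y) (N y u v) (J y w) + G (F y) (J y v) (N y u w)) differentiable at x"
    by (rule differentiable_add[OF differentiableI[OF metric_along[OF x N_deriv[OF x] J_deriv[OF x]]]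
          differentiableI[OF metric_along[OF x J_deriv[OF x] N_deriv[OF x]]]])
qed

text \<open>From here the induced metric has its own connection theory, under the prefix
  \<open>I\<close>.\<close>

sublocale I: metric_patch S \<gamma>
  by (rule metric_patch.intro[OF open_dom induced_inner differentiableI[OF induced_deriv] induced_deriv_differentiable])

lemma tangential:
  assumes x: "x \<in> S" shows "\<gamma> x (tangential G F x w) v = G (F x) w (J x v)"
proof -
  interpret i: inner_form "G (F x)" by (rule U.inner[OF F_in[OF x]])
  have "linear (\<lambda>v. G (F x) w (J x v))"
    by (auto intro!: linearI simp: linear_add[OF linear_J[OF x]] linear_cmul[OF linear_J[OF x]] i.algebra)
  from inner_form.ex1_representation[OF I.inner[OF x] this]
  have "\<exists>!u. \<forall>v. G (F x) (w - J x u) (J x v) = 0"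
    by (simp add: induced_metric_def i.algebra eq_commute[of "G (F x) w _"])
  from theI'[OF this] have "G (F x) (w - J x (tangential G F x w)) (J x v) = 0"
    unfolding tangential_def by blast
  then show ?thesis by (simp add: induced_metric_def i.algebra(3))
qed

text \<open>The intrinsic connection is the tangential part of the ambient one: of the six terms in
  the Koszul expression of the induced metric, symmetry of \<open>N\<close> cancels four and makes
  the other two equal.\<close>

lemma induced_christoffel:
  assumes x: "x \<in> S" shows "\<gamma> x (christoffel \<gamma> x u v) z = G (F x) (N x u v) (J x z)"
proof -
  interpret i: inner_form "G (F x)" by (rule U.inner[OF F_in[OF x]])
  show ?thesis
    by (simp add: I.christoffel[OF x] I.koszul_def D_eqI[OF induced_deriv[OF x]]
        N_sym[OF x, of v u] N_sym[OF x, of z u] N_sym[OF x, of z v] i.sym[of "J x _" "N x _ _"])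
qed

abbreviation \<sigma> where "\<sigma> \<equiv> second_fundamental_form G F"

lemma gauss_formula: "x \<in> S \<Longrightarrow> \<sigma> x u v = N x u v - J x (christoffel \<gamma> x u v)"
proof -
  assume x: "x \<in> S"
  have "tangential G F x (N x u v) = christoffel \<gamma> x u v"
    by (rule inner_form.eqI[OF I.inner[OF x]]) (simp only: tangential[OF x] induced_christoffel[OF x])
  then show ?thesis by (simp add: second_fundamental_form_def)
qed

lemma \<sigma>_normal: "x \<in> S \<Longrightarrow> G (F x) (\<sigma> x u v) (J x z) = 0"
  using induced_christoffel[of x u v z] bilinear_lsub[OF inner_form.bil[OF U.inner[OF F_in]], of x]
  by (simp add: gauss_formula induced_metric_def)

lemma \<sigma>_sym: "x \<in> S \<Longrightarrow> \<sigma> x u v = \<sigma> x v u"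
  by (simp add: gauss_formula N_sym[of x u] I.christoffel_sym[of x u])

lemma \<sigma>_bilinear: "x \<in> S \<Longrightarrow> bilinear (\<sigma> x)"
proof -
  assume x: "x \<in> S"
  note b = N_bilinear[OF x] I.bilinear_christoffel[OF x] and l = linear_J[OF x]
  show ?thesis
    unfolding bilinear_def gauss_formula[OF x]
    by (auto intro!: linearI simp: gauss_formula[OF x] bilinear_ladd[OF b(1)] bilinear_ladd[OF b(2)] bilinear_radd[OF b(1)] bilinear_radd[OF b(2)]
        bilinear_lmul[OF b(1)] bilinear_lmul[OF b(2)] bilinear_rmul[OF b(1)] bilinear_rmul[OF b(2)]
        linear_add[OF l] linear_cmul[OF l] algebra_simps)
qed

text \<open>Half of the Gauss equation, before antisymmetrizing in u and v. The function
  \<gamma>(\<nabla>_v w, z) is differentiated once with the intrinsic and once with the ambient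
  Leibniz rule, and the results are compared.\<close>

lemma christoffel_derivative:
  assumes x: "x \<in> S"
  shows "\<gamma> x (D (\<lambda>y. christoffel \<gamma> y v w) x u + christoffel \<gamma> x u (christoffel \<gamma> x v w)) z
    = G (F x) (D (\<lambda>y. N y v w) x u + christoffel G (F x) (J x u) (N x v w)) (J x z)
      + G (F x) (\<sigma> x v w) (\<sigma> x u z)"
proof -
  interpret i: inner_form "G (F x)" by (rule U.inner[OF F_in[OF x]])
  interpret j: inner_form "\<gamma> x" by (rule I.inner[OF x])
  let ?C = "christoffel \<gamma> x"
  have "((\<lambda>y. \<gamma> y (christoffel \<gamma> y v w) z) has_derivative
    (\<lambda>u. D (\<lambda>y. \<gamma> y (?C v w) z) x u + \<gamma> x (D (\<lambda>y. christoffel \<gamma> y v w) x u) z + \<gamma> x (?C v w) 0)) (at x)"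
    by (rule has_derivative_bilinear_family[OF open_dom x _ _ D_works has_derivative_const])
      (auto intro!: inner_form.bil I.inner I.G_diff I.christoffel_differentiable x)
  then have "D (\<lambda>y. \<gamma> y (christoffel \<gamma> y v w) z) x u =
      \<gamma> x (?C u (?C v w)) z + \<gamma> x (?C v w) (?C u z) + \<gamma> x (D (\<lambda>y. christoffel \<gamma> y v w) x u) z"
    by (simp add: D_eqI I.metric_compatible[OF x] j.algebra)
  moreover have N: "((\<lambda>y. N y v w) has_derivative D (\<lambda>y. N y v w) x) (at x)"
    by (rule D_works[OF differentiableI[OF N_deriv[OF x]]])
  have "((\<lambda>y. \<gamma> y (christoffel \<gamma> y v w) z) has_derivative
    (\<lambda>u. G (F x) (D (\<lambda>y. N y v w) x u + christoffel G (F x) (J x u) (N x v w)) (J x z)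
      + G (F x) (N x v w) (N x u z))) (at x)"
    by (rule has_derivative_transform_within_open[OF metric_along[OF x N J_deriv[OF x, of z], folded N_eq] open_dom x])
      (simp add: induced_christoffel)
  then have "D (\<lambda>y. \<gamma> y (christoffel \<gamma> y v w) z) x u =
      G (F x) (D (\<lambda>y. N y v w) x u + christoffel G (F x) (J x u) (N x v w)) (J x z)
      + G (F x) (N x v w) (N x u z)"
    by (simp add: D_eqI)
  moreover have "\<gamma> x (?C v w) (?C u z) = G (F x) (N x v w) (J x (?C u z))"
    by (rule induced_christoffel[OF x])
  \<comment> \<open>\<open>N x u z\<close> minus its tangential part is
    \<open>\<sigma> x u z\<close>, which is normal and so pairs only with the normal part of
    \<open>N x v w\<close>.\<close>
  moreover have "G (F x) (N x v w) (N x u z) - G (F x) (N x v w) (J x (?C u z)) = G (F x) (\<sigma> x v w) (\<sigma> x u z)"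
  proof -
    have "G (F x) (N x v w) (N x u z) - G (F x) (N x v w) (J x (?C u z))
        = G (F x) (\<sigma> x v w + J x (?C v w)) (\<sigma> x u z)"
      by (simp add: gauss_formula[OF x] i.algebra)
    also have "\<dots> = G (F x) (\<sigma> x v w) (\<sigma> x u z)"
      by (simp add: i.algebra i.sym[of "J x _"] \<sigma>_normal[OF x])
    finally show ?thesis .
  qed
  ultimately show ?thesis by (simp add: j.algebra)
qed

theorem gauss_equation:
  assumes x: "x \<in> S"
  shows "\<gamma> x (curvature \<gamma> x u v w) z = G (F x) (curvature G (F x) (J x u) (J x v) (J x w)) (J x z)
    + G (F x) (\<sigma> x v w) (\<sigma> x u z) - G (F x) (\<sigma> x u w) (\<sigma> x v z)"
proof -
  interpret i: inner_form "G (F x)" by (rule U.inner[OF F_in[OF x]])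
  interpret j: inner_form "\<gamma> x" by (rule I.inner[OF x])
  note b = U.bilinear_christoffel[OF F_in[OF x]]
  \<comment> \<open>The third derivatives of F and all terms containing \<open>hess\<close> are
    symmetric in u and v and cancel; what survives is the coordinate formula for the ambient
    curvature.\<close>
  have "D (\<lambda>y. N y v w) x u + christoffel G (F x) (J x u) (N x v w)
      - (D (\<lambda>y. N y u w) x v + christoffel G (F x) (J x v) (N x u w))
      = curvature G (F x) (J x u) (J x v) (J x w)"
    unfolding D_eqI[OF N_deriv[OF x]]
    by (simp add: U.curvature_eq[OF F_in[OF x]] N_eq bilinear_radd[OF b]
        hess_sym[OF x, of u v] hess_D_sym[OF x, where u = v and v = u])
  then show ?thesis
    using christoffel_derivative[OF x, of v w u z] christoffel_derivative[OF x, of u w v z]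
    by (simp add: I.curvature_eq[OF x] i.algebra(3) j.algebra(3) flip: \<open>_ = curvature G (F x) (J x u) (J x v) (J x w)\<close>)
qed

end

section \<open>Contact metric structures\<close>

text \<open>Smoothness of \<eta> is required because closedness of d\<eta> involves its second
  derivatives; \<phi> and \<xi> are differentiated once.\<close>

locale contact_patch = metric_patch U G
  for U :: "'e::euclidean_space set" and G +
  fixes \<phi> :: "'e \<Rightarrow> 'e \<Rightarrow> 'e" and \<xi> :: "'e \<Rightarrow> 'e" and \<eta> :: "'e \<Rightarrow> 'e \<Rightarrow> real"
  assumes \<phi>_linear: "x \<in> U \<Longrightarrow> linear (\<phi> x)"
    and \<phi>_diff: "x \<in> U \<Longrightarrow> (\<lambda>y. \<phi> y u) differentiable at x"
    and \<xi>_diff: "x \<in> U \<Longrightarrow> \<xi> differentiable at x"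
    and \<eta>_linear: "x \<in> U \<Longrightarrow> linear (\<eta> x)"
    and \<eta>_smooth: "smooth_on U (\<lambda>x. \<eta> x u)"
    and \<phi>_\<phi>: "x \<in> U \<Longrightarrow> \<phi> x (\<phi> x u) = - u + \<eta> x u *\<^sub>R \<xi> x"
    and \<eta>_\<xi>: "x \<in> U \<Longrightarrow> \<eta> x (\<xi> x) = 1"
    and \<eta>_\<phi>: "x \<in> U \<Longrightarrow> \<eta> x (\<phi> x u) = 0"
    and G_\<phi>_\<phi>: "x \<in> U \<Longrightarrow> G x u v = G x (\<phi> x u) (\<phi> x v) + \<eta> x u * \<eta> x v"
    and G_\<xi>: "x \<in> U \<Longrightarrow> G x u (\<xi> x) = \<eta> x u"
    and \<phi>_skew: "x \<in> U \<Longrightarrow> G x u (\<phi> x v) = - G x (\<phi> x u) v"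
    and contact: "x \<in> U \<Longrightarrow> ext_deriv \<eta> x u v = G x u (\<phi> x v)"
begin

abbreviation \<Phi> where "\<Phi> x u v \<equiv> G x u (\<phi> x v)"

abbreviation h where "h x u \<equiv> (1 / 2) *\<^sub>R lie_derivative_endo \<xi> \<phi> x u"

text \<open>The Lie derivative of the metric along \<xi> on constant fields, for which [\<xi>, u] =
  - D\<xi>(u).\<close>

definition L\<^sub>G where
  "L\<^sub>G x u v = D (\<lambda>y. G y u v) x (\<xi> x) + G x (D \<xi> x u) v + G x u (D \<xi> x v)"

lemma D\<xi>_linear: "x \<in> U \<Longrightarrow> linear (D \<xi> x)"
  by (rule linear_frechet_derivative[OF \<xi>_diff])

lemma \<eta>_diff: "x \<in> U \<Longrightarrow> (\<lambda>y. \<eta> y u) differentiable at x"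
  by (rule smooth_on_differentiable[OF \<eta>_smooth])

lemma \<Phi>_bilinear: "x \<in> U \<Longrightarrow> bilinear (\<Phi> x)"
proof -
  assume x: "x \<in> U"
  interpret inner_form "G x" by (rule inner[OF x])
  show ?thesis
    unfolding bilinear_def
    by (auto intro!: linearI simp: linear_add[OF \<phi>_linear[OF x]] linear_cmul[OF \<phi>_linear[OF x]] algebra)
qed

lemma \<Phi>_deriv:
  assumes x: "x \<in> U"
  shows "((\<lambda>y. \<Phi> y u v) has_derivative
    (\<lambda>w. D (\<lambda>y. G y u (\<phi> x v)) x w + G x u (D (\<lambda>y. \<phi> y v) x w))) (at x)"
  by (rule has_derivative_linear_family[where L="\<lambda>y. G y u", OF open_S x])
    (auto intro: inner_form.linear_right inner G_diff x D_works \<phi>_diff)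

lemma \<Phi>_diff: "x \<in> U \<Longrightarrow> (\<lambda>y. \<Phi> y u v) differentiable at x"
  by (rule differentiableI[OF \<Phi>_deriv])

lemma \<Phi>_antisym: "x \<in> U \<Longrightarrow> \<Phi> x u v = - \<Phi> x v u"
  using \<phi>_skew[of x u v] inner_form.sym[OF inner, of x "\<phi> x u" v] by simp

lemma D_\<Phi>_antisym: "x \<in> U \<Longrightarrow> D (\<lambda>y. \<Phi> y u v) x w = - D (\<lambda>y. \<Phi> y v u) x w"
proof -
  assume x: "x \<in> U"
  have "((\<lambda>y. - \<Phi> y v u) has_derivative (\<lambda>w. - D (\<lambda>y. \<Phi> y v u) x w)) (at x)"
    by (intro has_derivative_minus D_works \<Phi>_diff x)
  then have "((\<lambda>y. \<Phi> y u v) has_derivative (\<lambda>w. - D (\<lambda>y. \<Phi> y v u) x w)) (at x)"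
    by (rule has_derivative_transform_within_open[OF _ open_S x]) (rule \<Phi>_antisym[symmetric])
  then show ?thesis by (simp add: D_eqI)
qed

lemma \<Phi>_closed:
  assumes x: "x \<in> U"
  shows "D (\<lambda>y. \<Phi> y u v) x w + D (\<lambda>y. \<Phi> y v w) x u + D (\<lambda>y. \<Phi> y w u) x v = 0"
proof -
  let ?e = "\<lambda>a b y. D (\<lambda>z. \<eta> z b) y a"
  have *: "D (\<lambda>y. \<Phi> y a b) x c = (D (?e a b) x c - D (?e b a) x c) * (1 / 2)" for a b c
  proof -
    have "((\<lambda>y. (?e a b y - ?e b a y) * (1 / 2)) has_derivative
        (\<lambda>c. (D (?e a b) x c - D (?e b a) x c) * (1 / 2))) (at x)"
      by (intro has_derivative_mult_left has_derivative_diff D_works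
          smooth_on_differentiable[OF smooth_on_D[OF \<eta>_smooth] x])
    then have "((\<lambda>y. \<Phi> y a b) has_derivative (\<lambda>c. (D (?e a b) x c - D (?e b a) x c) * (1 / 2))) (at x)"
      by (rule has_derivative_transform_within_open[OF _ open_S x]) (simp add: ext_deriv_def flip: contact)
    then show ?thesis by (simp add: D_eqI)
  qed
  \<comment> \<open>The six second derivatives of \<eta> cancel in pairs: d(d\<eta>) = 0.\<close>
  have "D (?e a b) x c = D (?e c b) x a" for a b c
    by (rule D_commute[OF open_S x \<eta>_smooth])
  from this[where a=u and b=v and c=w] this[where a=v and b=u and c=w] this[where a=v and b=w and c=u] show ?thesis
    unfolding * by (simp add: diff_divide_distrib)
qed

lemma D_\<eta>_\<xi>:
  assumes x: "x \<in> U" shows "D (\<lambda>y. \<eta> y (\<xi> x)) x u = - \<eta> x (D \<xi> x u)"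
proof -
  have "((\<lambda>y. \<eta> y (\<xi> y)) has_derivative (\<lambda>u. D (\<lambda>y. \<eta> y (\<xi> x)) x u + \<eta> x (D \<xi> x u))) (at x)"
    by (rule has_derivative_linear_family[OF open_S x \<eta>_linear \<eta>_diff[OF x] D_works[OF \<xi>_diff[OF x]]])
  then have "((\<lambda>y. 1::real) has_derivative (\<lambda>u. D (\<lambda>y. \<eta> y (\<xi> x)) x u + \<eta> x (D \<xi> x u))) (at x)"
    by (rule has_derivative_transform_within_open[OF _ open_S x]) (rule \<eta>_\<xi>)
  from D_eqI[OF this] show ?thesis
    by (simp add: fun_eq_iff eq_neg_iff_add_eq_0 eq_commute[of 0])
qed

text \<open>In invariant terms L_\<xi> \<eta> = 0, because \<eta>(\<xi>) is constant and
  d\<eta>(\<xi>, u) = 0.\<close>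

lemma D_\<eta>_along_\<xi>:
  assumes x: "x \<in> U" shows "D (\<lambda>y. \<eta> y u) x (\<xi> x) = - \<eta> x (D \<xi> x u)"
proof -
  have "\<Phi> x (\<xi> x) u = 0"
    using inner_form.sym[OF inner[OF x], of "\<xi> x"] G_\<xi>[OF x] \<eta>_\<phi>[OF x] by simp
  then have "ext_deriv \<eta> x (\<xi> x) u = 0" by (simp add: contact[OF x])
  then show ?thesis by (simp add: ext_deriv_def D_\<eta>_\<xi>[OF x])
qed

lemma L\<^sub>G_sym: "x \<in> U \<Longrightarrow> L\<^sub>G x u v = L\<^sub>G x v u"
  using inner_form.sym[OF inner, of x u "D \<xi> x v"] inner_form.sym[OF inner, of x "D \<xi> x u" v]
  by (simp add: L\<^sub>G_def D_sym[of x u v])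

lemma L\<^sub>G_linear: "x \<in> U \<Longrightarrow> linear (L\<^sub>G x u)"
proof -
  assume x: "x \<in> U"
  interpret inner_form "G x" by (rule inner[OF x])
  show ?thesis
    by (rule linearI) (simp_all add: L\<^sub>G_def algebra linear_add[OF linear_D(3)[OF x]] linear_cmul[OF linear_D(3)[OF x]]
        linear_add[OF D\<xi>_linear[OF x]] linear_cmul[OF D\<xi>_linear[OF x]] distrib_left)
qed

lemma double_h: "x \<in> U \<Longrightarrow>
    2 *\<^sub>R h x u = D (\<lambda>y. \<phi> y u) x (\<xi> x) - D \<xi> x (\<phi> x u) + \<phi> x (D \<xi> x u)"
  by (simp add: lie_derivative_endo_def lie_bracket_def linear_neg[OF \<phi>_linear])

lemma h_linear: "x \<in> U \<Longrightarrow> linear (h x)"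
proof -
  assume x: "x \<in> U"
  have l: "linear (\<lambda>u. D (\<lambda>y. \<phi> y u) x (\<xi> x))"
    by (rule linear_D_family[OF open_S x \<phi>_linear \<phi>_diff[OF x]])
  have *: "lie_derivative_endo \<xi> \<phi> x u = D (\<lambda>y. \<phi> y u) x (\<xi> x) - D \<xi> x (\<phi> x u) + \<phi> x (D \<xi> x u)" for u
    using double_h[OF x, of u] by simp
  show ?thesis
    unfolding *
    by (intro linearI) (simp_all add: linear_add[OF l] linear_cmul[OF l] linear_add[OF \<phi>_linear[OF x]]
        linear_cmul[OF \<phi>_linear[OF x]] linear_add[OF D\<xi>_linear[OF x]] linear_cmul[OF D\<xi>_linear[OF x]]
        algebra_simps)
qed

text \<open>This is \<open>L\<^sub>\<xi> \<Phi> = 0\<close>: \<open>\<Phi> = d\<eta>\<close> is closed and \<open>\<xi>\<close> contracts it to zero.\<close>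

lemma \<Phi>_invariant:
  assumes x: "x \<in> U"
  shows "D (\<lambda>y. \<Phi> y u v) x (\<xi> x) = - \<Phi> x (D \<xi> x u) v - \<Phi> x u (D \<xi> x v)"
proof -
  have *: "D (\<lambda>y. \<Phi> y (\<xi> x) v) x u = - \<Phi> x (D \<xi> x u) v" for u v
  proof -
    have "((\<lambda>y. \<Phi> y (\<xi> y) v) has_derivative (\<lambda>u. D (\<lambda>y. \<Phi> y (\<xi> x) v) x u + \<Phi> x (D \<xi> x u) v)) (at x)"
      using \<Phi>_bilinear
      by (intro has_derivative_linear_family[where L="\<lambda>y u. \<Phi> y u v", OF open_S x _ \<Phi>_diff[OF x] D_works[OF \<xi>_diff[OF x]]])
        (simp add: bilinear_def)
    then have "((\<lambda>y. 0) has_derivative (\<lambda>u. D (\<lambda>y. \<Phi> y (\<xi> x) v) x u + \<Phi> x (D \<xi> x u) v)) (at x)"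
      by (rule has_derivative_transform_within_open[OF _ open_S x])
        (metis inner_form.sym[OF inner] G_\<xi> \<eta>_\<phi>)
    from D_eqI[OF this] show ?thesis
      by (simp add: fun_eq_iff eq_neg_iff_add_eq_0 eq_commute[of 0])
  qed
  show ?thesis
    using \<Phi>_closed[OF x, of u v "\<xi> x"] *[of v u] *[of u v] D_\<Phi>_antisym[OF x, of v "\<xi> x" u]
      \<Phi>_antisym[OF x, of u "D \<xi> x v"]
    by simp
qed

text \<open>The Leibniz rule for \<Phi>(u, v) = G(u, \<phi> v) under L_\<xi>, with L_\<xi> \<Phi> =
  0 and L_\<xi> \<phi> = 2 h.\<close>

lemma L\<^sub>G_\<phi>:
  assumes x: "x \<in> U" shows "L\<^sub>G x u (\<phi> x v) = - 2 * G x u (h x v)"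
proof -
  interpret inner_form "G x" by (rule inner[OF x])
  have "2 * G x u (h x v) = G x u (D (\<lambda>y. \<phi> y v) x (\<xi> x)) - G x u (D \<xi> x (\<phi> x v)) + \<Phi> x u (D \<xi> x v)"
    using arg_cong[OF double_h[OF x, of v], of "G x u"] by (simp add: algebra del: scaleR_scaleR)
  moreover have "D (\<lambda>y. \<Phi> y u v) x (\<xi> x) = D (\<lambda>y. G y u (\<phi> x v)) x (\<xi> x) + G x u (D (\<lambda>y. \<phi> y v) x (\<xi> x))"
    by (simp add: D_eqI[OF \<Phi>_deriv[OF x]])
  ultimately show ?thesis
    using \<Phi>_invariant[OF x, of u v] unfolding L\<^sub>G_def by linarith
qed

text \<open>As [\<xi>, \<xi>] = 0 and G(u, \<xi>) = \<eta>(u), this is L_\<xi> \<eta> = 0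
  again.\<close>

lemma L\<^sub>G_\<xi>:
  assumes x: "x \<in> U" shows "L\<^sub>G x u (\<xi> x) = 0"
proof -
  have "((\<lambda>y. G y u (\<xi> y)) has_derivative (\<lambda>w. D (\<lambda>y. G y u (\<xi> x)) x w + G x u (D \<xi> x w))) (at x)"
    by (rule has_derivative_linear_family[where L="\<lambda>y. G y u", OF open_S x])
      (auto intro: inner_form.linear_right inner G_diff x D_works \<xi>_diff)
  then have "((\<lambda>y. \<eta> y u) has_derivative (\<lambda>w. D (\<lambda>y. G y u (\<xi> x)) x w + G x u (D \<xi> x w))) (at x)"
    by (rule has_derivative_transform_within_open[OF _ open_S x]) (rule G_\<xi>)
  then show ?thesis
    using D_\<eta>_along_\<xi>[OF x, of u] by (simp add: D_eqI L\<^sub>G_def G_\<xi>[OF x])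
qed

text \<open>Applying L_\<xi> to the compatibility of G with \<phi> adds two terms in
  \<open>h\<close> to the value at (\<phi> u, \<phi> v). By \<open>L\<^sub>G_\<phi>\<close> each of
  them is minus that value, so the sign flips.\<close>

lemma L\<^sub>G_\<phi>_\<phi>:
  assumes x: "x \<in> U" shows "L\<^sub>G x u v = - L\<^sub>G x (\<phi> x u) (\<phi> x v)"
proof -
  interpret inner_form "G x" by (rule inner[OF x])
  have "((\<lambda>y. G y (\<phi> y u) (\<phi> y v) + \<eta> y u * \<eta> y v) has_derivative
    (\<lambda>w. (D (\<lambda>y. G y (\<phi> x u) (\<phi> x v)) x w + G x (D (\<lambda>y. \<phi> y u) x w) (\<phi> x v) + G x (\<phi> x u) (D (\<lambda>y. \<phi> y v) x w))
      + (\<eta> x u * D (\<lambda>y. \<eta> y v) x w + D (\<lambda>y. \<eta> y u) x w * \<eta> x v))) (at x)"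
    by (intro has_derivative_add has_derivative_mult has_derivative_bilinear_family[OF open_S x] D_works
        \<phi>_diff \<eta>_diff G_diff x inner_form.bil[OF inner])
  then have "((\<lambda>y. G y u v) has_derivative
    (\<lambda>w. (D (\<lambda>y. G y (\<phi> x u) (\<phi> x v)) x w + G x (D (\<lambda>y. \<phi> y u) x w) (\<phi> x v) + G x (\<phi> x u) (D (\<lambda>y. \<phi> y v) x w))
      + (\<eta> x u * D (\<lambda>y. \<eta> y v) x w + D (\<lambda>y. \<eta> y u) x w * \<eta> x v))) (at x)"
    by (rule has_derivative_transform_within_open[OF _ open_S x]) (rule G_\<phi>_\<phi>[symmetric])
  then have deriv: "D (\<lambda>y. G y u v) x (\<xi> x) =
      D (\<lambda>y. G y (\<phi> x u) (\<phi> x v)) x (\<xi> x) + G x (D (\<lambda>y. \<phi> y u) x (\<xi> x)) (\<phi> x v)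
      + G x (\<phi> x u) (D (\<lambda>y. \<phi> y v) x (\<xi> x)) - \<eta> x u * \<eta> x (D \<xi> x v) - \<eta> x (D \<xi> x u) * \<eta> x v"
    by (simp add: D_eqI D_\<eta>_along_\<xi>[OF x])
  have d\<phi>: "D (\<lambda>y. \<phi> y u) x (\<xi> x) = 2 *\<^sub>R h x u + D \<xi> x (\<phi> x u) - \<phi> x (D \<xi> x u)" for u
    unfolding double_h[OF x] by simp
  have "L\<^sub>G x u v = L\<^sub>G x (\<phi> x u) (\<phi> x v) + 2 * G x (h x u) (\<phi> x v) + 2 * G x (\<phi> x u) (h x v)"
    unfolding L\<^sub>G_def deriv d\<phi> G_\<phi>_\<phi>[OF x, of "D \<xi> x u" v] G_\<phi>_\<phi>[OF x, of u "D \<xi> x v"]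
    by (simp add: algebra)
  then show ?thesis
    using L\<^sub>G_\<phi>[OF x, of "\<phi> x u" v] L\<^sub>G_\<phi>[OF x, of "\<phi> x v" u] sym[of "h x u" "\<phi> x v"]
      L\<^sub>G_sym[OF x, of "\<phi> x u" "\<phi> x v"]
    by simp
qed

lemma h_sym:
  assumes x: "x \<in> U" shows "G x (h x u) v = G x u (h x v)"
proof -
  have "L\<^sub>G x u (\<phi> x v) = - L\<^sub>G x (\<phi> x u) (\<phi> x (\<phi> x v))" by (rule L\<^sub>G_\<phi>_\<phi>[OF x])
  also have "\<dots> = L\<^sub>G x (\<phi> x u) v"
    unfolding \<phi>_\<phi>[OF x]
    by (simp add: linear_add[OF L\<^sub>G_linear[OF x]] linear_neg[OF L\<^sub>G_linear[OF x]]
        linear_cmul[OF L\<^sub>G_linear[OF x]] L\<^sub>G_\<xi>[OF x] linear_diff[OF L\<^sub>G_linear[OF x]])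
  also have "\<dots> = L\<^sub>G x v (\<phi> x u)" by (rule L\<^sub>G_sym[OF x])
  finally have "G x u (h x v) = G x v (h x u)" unfolding L\<^sub>G_\<phi>[OF x] by simp
  then show ?thesis by (simp only: inner_form.sym[OF inner[OF x], of "h x u" v])
qed

lemma \<phi>h_sym:
  assumes x: "x \<in> U" shows "G x (\<phi> x (h x u)) v = G x u (\<phi> x (h x v))"
proof -
  interpret inner_form "G x" by (rule inner[OF x])
  have "2 * G x (\<phi> x (h x u)) v = L\<^sub>G x (\<phi> x v) (\<phi> x u)" for u v
    using L\<^sub>G_\<phi>[OF x, of "\<phi> x v" u] \<phi>_skew[OF x, of "h x u" v] sym[of "h x u" "\<phi> x v"] by simp
  from this[of u v] this[of v u] show ?thesis
    using L\<^sub>G_sym[OF x, of "\<phi> x v" "\<phi> x u"] sym[of u "\<phi> x (h x v)"] by simp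
qed

end

locale C_totally_real_patch = contact_patch U G \<phi> \<xi> \<eta> + immersed_patch U G S F
  for U :: "'e::euclidean_space set" and G \<phi> \<xi> \<eta> and S :: "'d::euclidean_space set" and F +
  assumes \<xi>_normal: "x \<in> S \<Longrightarrow> G (F x) (\<xi> (F x)) (push F x u) = 0"
begin

lemma \<eta>_J: "x \<in> S \<Longrightarrow> \<eta> (F x) (J x u) = 0"
  using \<xi>_normal[of x u] G_\<xi>[OF F_in, of x "J x u"] inner_form.sym[OF inner[OF F_in], of x "\<xi> (F x)"] by simp

lemma \<phi>_J_normal:
  assumes x: "x \<in> S" shows "G (F x) (J x u) (\<phi> (F x) (J x v)) = 0"
proof -
  \<comment> \<open>Differentiating \<eta>(J v) = 0 along M. The right side is symmetric in u and v,
    so the antisymmetric d\<eta> vanishes on tangent vectors.\<close>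
  have *: "D (\<lambda>z. \<eta> z (J x v)) (F x) (J x u) = - \<eta> (F x) (hess x u v)" for u v
  proof -
    have "((\<lambda>y. \<eta> (F y) (J y v)) has_derivative
        (\<lambda>u. D (\<lambda>y. \<eta> (F y) (J x v)) x u + \<eta> (F x) (hess x u v))) (at x)"
      by (rule has_derivative_linear_family[OF open_dom x \<eta>_linear[OF F_in]
            comp_differentiable(1)[OF x \<eta>_diff[OF F_in[OF x]]] J_deriv[OF x]])
    then have "((\<lambda>y. 0) has_derivative
        (\<lambda>u. D (\<lambda>y. \<eta> (F y) (J x v)) x u + \<eta> (F x) (hess x u v))) (at x)"
      by (rule has_derivative_transform_within_open[OF _ open_dom x]) (rule \<eta>_J)
    from D_eqI[OF this] show ?thesis
      by (simp add: fun_eq_iff eq_neg_iff_add_eq_0 eq_commute[of 0] comp_differentiable(2)[OF x \<eta>_diff[OF F_in[OF x]]])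
  qed
  show ?thesis
    unfolding contact[OF F_in[OF x], symmetric] ext_deriv_def * hess_sym[OF x, of u v] by simp
qed

end

section \<open>Ricci curvature of \<open>C\<close>-totally real submanifolds\<close>

context inner_form
begin

lemma trace_tail:
  assumes e: "orthonormal_basis ip e" and L: "linear L"
  shows "(\<Sum>j=1..<DIM('e). ip (L (e j)) (e j)) = endo_trace L - ip (L (e 0)) (e 0)"
  unfolding endo_trace_eq[OF e L] lessThan_atLeast0
  by (subst sum.atLeast_Suc_lessThan[of 0]) simp_all

text \<open>Parseval for the squared length of L(e 0), with the j = 0 term split off.\<close>

lemma self_adjoint_tail:
  assumes e: "orthonormal_basis ip e" and L: "\<And>u v. ip (L u) v = ip u (L v)"
  shows "(\<Sum>j=1..<DIM('e). ip (L (e 0)) (e j) * ip (L (e j)) (e 0))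
    = ip (L (e 0)) (L (e 0)) - ip (L (e 0)) (e 0) * ip (L (e 0)) (e 0)"
proof -
  have "ip (L (e 0)) (L (e 0)) = (\<Sum>j<DIM('e). ip (L (e 0)) (e j) * ip (L (e j)) (e 0))"
    unfolding parseval[OF e, of "L (e 0)" "L (e 0)"]
    by (simp only: L[of "e _" "e 0"] sym[of "L (e 0)"])
  then show ?thesis
    unfolding lessThan_atLeast0 by (subst (asm) sum.atLeast_Suc_lessThan[of 0]) simp_all
qed

text \<open>The Ricci-type contraction of \<open>(u, v) \<mapsto> L v \<and> L u\<close>, i.e. of the tensors
  \<open>R\<^sub>5\<^sub>,\<^sub>1\<close> and \<open>R\<^sub>5\<^sub>,\<^sub>2\<close>.\<close>

lemma wedge_square_contraction:
  assumes "orthonormal_basis ip e" and "linear L" and "\<And>u v. ip (L u) v = ip u (L v)"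
  shows "(\<Sum>j=1..<DIM('e). ip (L (e j)) (e j) * ip (L (e 0)) (e 0) - ip (L (e 0)) (e j) * ip (L (e j)) (e 0))
    = endo_trace L * ip (L (e 0)) (e 0) - ip (L (e 0)) (L (e 0))"
proof -
  have "(\<Sum>j=1..<DIM('e). ip (L (e j)) (e j) * ip (L (e 0)) (e 0))
      = (endo_trace L - ip (L (e 0)) (e 0)) * ip (L (e 0)) (e 0)"
    by (simp only: sum_distrib_right[symmetric] trace_tail[OF assms(1,2)])
  then show ?thesis
    by (simp only: sum_subtractf self_adjoint_tail[OF assms(1,3)]) (simp add: algebra_simps)
qed

end

lemma (in immersed_patch) mean_curvature:
  assumes x: "x \<in> S" and e: "orthonormal_basis (\<gamma> x) e"
  shows "(\<Sum>i<DIM('d). \<sigma> x (e i) (e i)) = real DIM('d) *\<^sub>R mean_curvature G F x"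
proof -
  interpret inner_form "\<gamma> x" by (rule I.inner[OF x])
  have "orthonormal_basis (\<gamma> x) (SOME e. orthonormal_basis (\<gamma> x) e)"
    using e by (rule someI[of "orthonormal_basis (\<gamma> x)"])
  then have "(\<Sum>i<DIM('d). \<sigma> x ((SOME e. orthonormal_basis (\<gamma> x) e) i) ((SOME e. orthonormal_basis (\<gamma> x) e) i))
      = (\<Sum>i<DIM('d). \<sigma> x (e i) (e i))"
    by (rule trace_independent[OF _ e \<sigma>_bilinear[OF x]])
  then show ?thesis by (simp add: mean_curvature_def Let_def)
qed

context C_totally_real_patch
begin

definition hT :: "'d \<Rightarrow> 'd \<Rightarrow> 'd" where
  "hT x u = tangential G F x (h (F x) (J x u))"

definition \<phi>hT :: "'d \<Rightarrow> 'd \<Rightarrow> 'd" where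
  "\<phi>hT x u = tangential G F x (\<phi> (F x) (h (F x) (J x u)))"

lemma linear_tangential: "x \<in> S \<Longrightarrow> linear (tangential G F x)"
proof -
  assume x: "x \<in> S"
  interpret i: inner_form "G (F x)" by (rule inner[OF F_in[OF x]])
  interpret j: inner_form "\<gamma> x" by (rule I.inner[OF x])
  show ?thesis
  proof (rule linearI)
    fix a b c
    show "tangential G F x (a + b) = tangential G F x a + tangential G F x b"
      by (rule j.eqI) (simp only: j.algebra(1) i.algebra(1) tangential[OF x])
    show "tangential G F x (c *\<^sub>R a) = c *\<^sub>R tangential G F x a"
      by (rule j.eqI) (simp only: j.algebra(5) i.algebra(5) tangential[OF x])
  qed
qed

lemma linear_hT:
  assumes x: "x \<in> S" shows "linear (hT x)"
  using linear_compose[OF linear_compose[OF linear_J[OF x] h_linear[OF F_in[OF x]]] linear_tangential[OF x]]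
  by (simp only: comp_def hT_def[abs_def])

lemma linear_\<phi>hT:
  assumes x: "x \<in> S" shows "linear (\<phi>hT x)"
  using linear_compose[OF linear_compose[OF linear_compose[OF linear_J[OF x] h_linear[OF F_in[OF x]]]
      \<phi>_linear[OF F_in[OF x]]] linear_tangential[OF x]]
  by (simp only: comp_def \<phi>hT_def[abs_def])

lemma hT: "x \<in> S \<Longrightarrow> \<gamma> x (hT x u) v = G (F x) (h (F x) (J x u)) (J x v)"
  by (simp only: hT_def tangential)

lemma \<phi>hT: "x \<in> S \<Longrightarrow> \<gamma> x (\<phi>hT x u) v = G (F x) (\<phi> (F x) (h (F x) (J x u))) (J x v)"
  by (simp only: \<phi>hT_def tangential)

text \<open>The compression of a self-adjoint map to the tangent space is self-adjoint.\<close>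

lemma hT_sym:
  assumes x: "x \<in> S" shows "\<gamma> x (hT x u) v = \<gamma> x u (hT x v)"
proof -
  have "\<gamma> x (hT x u) v = G (F x) (J x u) (h (F x) (J x v))"
    by (simp only: hT[OF x] h_sym[OF F_in[OF x]])
  also have "\<dots> = G (F x) (h (F x) (J x v)) (J x u)"
    by (rule inner_form.sym[OF inner[OF F_in[OF x]]])
  also have "\<dots> = \<gamma> x (hT x v) u" by (rule hT[OF x, symmetric])
  also have "\<dots> = \<gamma> x u (hT x v)" by (rule inner_form.sym[OF I.inner[OF x]])
  finally show ?thesis .
qed

lemma \<phi>hT_sym:
  assumes x: "x \<in> S" shows "\<gamma> x (\<phi>hT x u) v = \<gamma> x u (\<phi>hT x v)"
proof -
  have "\<gamma> x (\<phi>hT x u) v = G (F x) (J x u) (\<phi> (F x) (h (F x) (J x v)))"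
    by (simp only: \<phi>hT[OF x] \<phi>h_sym[OF F_in[OF x]])
  also have "\<dots> = G (F x) (\<phi> (F x) (h (F x) (J x v))) (J x u)"
    by (rule inner_form.sym[OF inner[OF F_in[OF x]]])
  also have "\<dots> = \<gamma> x (\<phi>hT x v) u" by (rule \<phi>hT[OF x, symmetric])
  also have "\<dots> = \<gamma> x u (\<phi>hT x v)" by (rule inner_form.sym[OF I.inner[OF x]])
  finally show ?thesis .
qed

text \<open>\<open>R\<^sub>2\<close>, \<open>R\<^sub>3\<close> and \<open>R\<^sub>6\<close> do not contribute, since both \<open>\<xi>\<close> and \<open>\<phi>\<close> of a tangent vector are normal.\<close>

lemma sectional_curvature_eq:
  assumes x: "x \<in> S"
    and curv: "\<And>X Y Z. curvature G (F x) X Y Z =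
      c1 *\<^sub>R R1 (G (F x)) X Y Z + c2 *\<^sub>R R2 (G (F x)) (\<phi> (F x)) X Y Z
      + c3 *\<^sub>R R3 (G (F x)) (\<xi> (F x)) (\<eta> (F x)) X Y Z + c4 *\<^sub>R R4 (G (F x)) (h (F x)) X Y Z
      + c51 *\<^sub>R R51 (G (F x)) (h (F x)) X Y Z + c52 *\<^sub>R R52 (G (F x)) (\<phi> (F x)) (h (F x)) X Y Z
      + c6 *\<^sub>R R6 (G (F x)) (\<xi> (F x)) (\<eta> (F x)) (h (F x)) X Y Z"
    and uv: "\<gamma> x u u = 1" "\<gamma> x v v = 1" "\<gamma> x u v = 0"
  shows "sectional_curvature \<gamma> x u v =
    c1 + c4 * (\<gamma> x (hT x u) u + \<gamma> x (hT x v) v)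
    + c51 * (\<gamma> x (hT x v) v * \<gamma> x (hT x u) u - \<gamma> x (hT x u) v * \<gamma> x (hT x v) u)
    + c52 * (\<gamma> x (\<phi>hT x v) v * \<gamma> x (\<phi>hT x u) u - \<gamma> x (\<phi>hT x u) v * \<gamma> x (\<phi>hT x v) u)
    + (G (F x) (\<sigma> x u u) (\<sigma> x v v) - G (F x) (\<sigma> x u v) (\<sigma> x u v))"
proof -
  interpret i: inner_form "G (F x)" by (rule inner[OF F_in[OF x]])
  let ?X = "J x u" and ?Y = "J x v"
  have uv': "G (F x) ?X ?X = 1" "G (F x) ?Y ?Y = 1" "G (F x) ?X ?Y = 0" "G (F x) ?Y ?X = 0"
    using uv i.sym[of ?Y ?X] by (simp_all add: induced_metric_def)
  have "G (F x) (curvature G (F x) ?X ?Y ?Y) ?X = c1 + c4 * (\<gamma> x (hT x u) u + \<gamma> x (hT x v) v)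
    + c51 * (\<gamma> x (hT x v) v * \<gamma> x (hT x u) u - \<gamma> x (hT x u) v * \<gamma> x (hT x v) u)
    + c52 * (\<gamma> x (\<phi>hT x v) v * \<gamma> x (\<phi>hT x u) u - \<gamma> x (\<phi>hT x u) v * \<gamma> x (\<phi>hT x v) u)"
    unfolding curv hT[OF x] \<phi>hT[OF x] R1_def R2_def R3_def R4_def R51_def R52_def R6_def
    by (simp add: i.algebra uv' \<eta>_J[OF x] \<phi>_J_normal[OF x] del: scaleR_scaleR)
  then show ?thesis
    unfolding sectional_curvature_def gauss_equation[OF x]
    using i.sym[of "\<sigma> x v v"] by (simp add: \<sigma>_sym[OF x, of v u])
qed

text \<open>The coefficient n - 2 arises because the term of \<open>e 0\<close> occurs n - 1 times,
  while the trace over the remaining vectors lacks it once.\<close>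

lemma sum_sectional_curvature:
  assumes x: "x \<in> S"
    and curv: "\<And>X Y Z. curvature G (F x) X Y Z =
      c1 *\<^sub>R R1 (G (F x)) X Y Z + c2 *\<^sub>R R2 (G (F x)) (\<phi> (F x)) X Y Z
      + c3 *\<^sub>R R3 (G (F x)) (\<xi> (F x)) (\<eta> (F x)) X Y Z + c4 *\<^sub>R R4 (G (F x)) (h (F x)) X Y Z
      + c51 *\<^sub>R R51 (G (F x)) (h (F x)) X Y Z + c52 *\<^sub>R R52 (G (F x)) (\<phi> (F x)) (h (F x)) X Y Z
      + c6 *\<^sub>R R6 (G (F x)) (\<xi> (F x)) (\<eta> (F x)) (h (F x)) X Y Z"
    and e: "orthonormal_basis (\<gamma> x) e"
  shows "(\<Sum>j=1..<DIM('d). sectional_curvature \<gamma> x (e 0) (e j)) =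
    (real DIM('d) - 1) * c1
    + c4 * (endo_trace (hT x) + (real DIM('d) - 2) * \<gamma> x (hT x (e 0)) (e 0))
    + c51 * (endo_trace (hT x) * \<gamma> x (hT x (e 0)) (e 0) - \<gamma> x (hT x (e 0)) (hT x (e 0)))
    + c52 * (endo_trace (\<phi>hT x) * \<gamma> x (\<phi>hT x (e 0)) (e 0) - \<gamma> x (\<phi>hT x (e 0)) (\<phi>hT x (e 0)))
    + (\<Sum>j=1..<DIM('d). G (F x) (\<sigma> x (e 0) (e 0)) (\<sigma> x (e j) (e j))
        - G (F x) (\<sigma> x (e 0) (e j)) (\<sigma> x (e 0) (e j)))"
proof -
  interpret j: inner_form "\<gamma> x" by (rule I.inner[OF x])
  have n: "real (DIM('d) - Suc 0) = real DIM('d) - 1"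
    by (simp add: of_nat_diff Suc_le_eq)
  have "sectional_curvature \<gamma> x (e 0) (e j) =
    c1 + c4 * (\<gamma> x (hT x (e 0)) (e 0) + \<gamma> x (hT x (e j)) (e j))
    + c51 * (\<gamma> x (hT x (e j)) (e j) * \<gamma> x (hT x (e 0)) (e 0) - \<gamma> x (hT x (e 0)) (e j) * \<gamma> x (hT x (e j)) (e 0))
    + c52 * (\<gamma> x (\<phi>hT x (e j)) (e j) * \<gamma> x (\<phi>hT x (e 0)) (e 0) - \<gamma> x (\<phi>hT x (e 0)) (e j) * \<gamma> x (\<phi>hT x (e j)) (e 0))
    + (G (F x) (\<sigma> x (e 0) (e 0)) (\<sigma> x (e j) (e j)) - G (F x) (\<sigma> x (e 0) (e j)) (\<sigma> x (e 0) (e j)))"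
    if "j \<in> {1..<DIM('d)}" for j
    using that by (intro sectional_curvature_eq[OF x curv]) (auto simp: j.orthonormal[OF e])
  then have "(\<Sum>j=1..<DIM('d). sectional_curvature \<gamma> x (e 0) (e j)) =
    (\<Sum>j=1..<DIM('d). c1) + c4 * ((\<Sum>j=1..<DIM('d). \<gamma> x (hT x (e 0)) (e 0)) + (\<Sum>j=1..<DIM('d). \<gamma> x (hT x (e j)) (e j)))
    + c51 * (\<Sum>j=1..<DIM('d). \<gamma> x (hT x (e j)) (e j) * \<gamma> x (hT x (e 0)) (e 0) - \<gamma> x (hT x (e 0)) (e j) * \<gamma> x (hT x (e j)) (e 0))
    + c52 * (\<Sum>j=1..<DIM('d). \<gamma> x (\<phi>hT x (e j)) (e j) * \<gamma> x (\<phi>hT x (e 0)) (e 0) - \<gamma> x (\<phi>hT x (e 0)) (e j) * \<gamma> x (\<phi>hT x (e j)) (e 0))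
    + (\<Sum>j=1..<DIM('d). G (F x) (\<sigma> x (e 0) (e 0)) (\<sigma> x (e j) (e j)) - G (F x) (\<sigma> x (e 0) (e j)) (\<sigma> x (e 0) (e j)))"
    by (simp only: sum.distrib sum_distrib_left[symmetric] cong: sum.cong)
  then show ?thesis
    unfolding j.trace_tail[OF e linear_hT[OF x]]
      j.wedge_square_contraction[OF e linear_hT[OF x] hT_sym[OF x]]
      j.wedge_square_contraction[OF e linear_\<phi>hT[OF x] \<phi>hT_sym[OF x]]
    by (simp add: n algebra_simps)
qed

end

section \<open>Charts\<close>

lemma metric_patch_riemannian:
  assumes "smooth_manifold T A" "riemannian_metric A g" "\<kappa> \<in> A"
  shows "metric_patch (chart_image \<kappa>) (g \<kappa>)"
proof (rule metric_patch.intro)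
  show "open (chart_image \<kappa>)" using assms by (auto simp: smooth_manifold_def)
  fix x u v w assume x: "x \<in> chart_image \<kappa>"
  have smooth: "smooth_on (chart_image \<kappa>) (\<lambda>x. g \<kappa> x u v)"
    using assms(2,3) by (auto simp: riemannian_metric_def)
  show "(\<lambda>y. g \<kappa> y u v) differentiable at x"
    by (rule smooth_on_differentiable[OF smooth x])
  show "(\<lambda>y. D (\<lambda>y. g \<kappa> y u v) y w) differentiable at x"
    by (rule smooth_on_differentiable[OF smooth_on_D[OF smooth] x])
next
  fix x assume x: "x \<in> chart_image \<kappa>"
  have "bilinear (g \<kappa> x) \<and> (\<forall>u v. g \<kappa> x u v = g \<kappa> x v u) \<and> (\<forall>u. u \<noteq> 0 \<longrightarrow> g \<kappa> x u u > 0)"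
    using assms(2,3) x unfolding riemannian_metric_def by blast
  then show "inner_form (g \<kappa> x)" by (intro inner_form.intro) auto
qed

lemma contact_patch_chart:
  assumes "contact_metric_manifold T A \<phi> \<xi> \<eta> g" "\<kappa> \<in> A"
  shows "contact_patch (chart_image \<kappa>) (g \<kappa>) (\<phi> \<kappa>) (\<xi> \<kappa>) (\<eta> \<kappa>)"
proof -
  note defs = contact_metric_manifold_def almost_contact_metric_manifold_def
  have ac: "smooth_manifold T A" "smooth_endo_field A \<phi>" "smooth_vector_field A \<xi>"
    "smooth_one_form A \<eta>" "riemannian_metric A g"
    using assms(1) unfolding defs by blast+
  show ?thesis
  proof (intro contact_patch.intro contact_patch_axioms.intro)
    show "metric_patch (chart_image \<kappa>) (g \<kappa>)"
      by (rule metric_patch_riemannian[OF ac(1,5) assms(2)])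
  next
    fix u show "smooth_on (chart_image \<kappa>) (\<lambda>x. \<eta> \<kappa> x u)"
      using ac(4) assms(2) by (auto simp: smooth_one_form_def)
  next
    fix x assume x: "x \<in> chart_image \<kappa>"
    show "linear (\<phi> \<kappa> x)" "linear (\<eta> \<kappa> x)"
      using ac(2,4) assms(2) x unfolding smooth_endo_field_def smooth_one_form_def by blast+
    show "\<xi> \<kappa> differentiable at x"
      using ac(3) assms(2) by (intro smooth_on_differentiable[OF _ x]) (simp add: smooth_vector_field_def)
    show "\<eta> \<kappa> x (\<xi> \<kappa> x) = 1"
      using assms x unfolding defs by blast
    fix u
    show "(\<lambda>y. \<phi> \<kappa> y u) differentiable at x"
      using ac(2) assms(2) by (intro smooth_on_differentiable[OF _ x]) (simp add: smooth_endo_field_def)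
    show "\<phi> \<kappa> x (\<phi> \<kappa> x u) = - u + \<eta> \<kappa> x u *\<^sub>R \<xi> \<kappa> x" "\<eta> \<kappa> x (\<phi> \<kappa> x u) = 0"
      "g \<kappa> x u (\<xi> \<kappa> x) = \<eta> \<kappa> x u"
      using assms x unfolding defs by blast+
    fix v
    show "g \<kappa> x u v = g \<kappa> x (\<phi> \<kappa> x u) (\<phi> \<kappa> x v) + \<eta> \<kappa> x u * \<eta> \<kappa> x v"
      "g \<kappa> x u (\<phi> \<kappa> x v) = - g \<kappa> x (\<phi> \<kappa> x u) v" "ext_deriv (\<eta> \<kappa>) x u v = g \<kappa> x u (\<phi> \<kappa> x v)"
      using assms x unfolding defs by blast+
  qed
qed

lemma chart_inv_apply:
  assumes "smooth_manifold T A" "\<kappa> \<in> A" "q \<in> fst \<kappa>"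
  shows "chart_inv \<kappa> (snd \<kappa> q) = q"
proof -
  have "openin T (fst \<kappa>)" "homeomorphic_map (subtopology T (fst \<kappa>)) (top_of_set (chart_image \<kappa>)) (snd \<kappa>)"
    using assms by (auto simp: smooth_manifold_def)
  then have "inj_on (snd \<kappa>) (fst \<kappa>)"
    using homeomorphic_imp_injective_map topspace_subtopology_subset[OF openin_subset] by metis
  then show ?thesis using assms(3) by (simp add: chart_inv_def)
qed

text \<open>M carries its own topology, so the ambient chart domain meets M in an open set only
  through continuity of the inclusion.\<close>

lemma open_chart_overlap:
  assumes "submanifold M B T A" "\<psi> \<in> B" "\<kappa> \<in> A"
  shows "open (snd \<psi> ` (fst \<psi> \<inter> fst \<kappa>))"
proof -
  have \<psi>: "openin M (fst \<psi>)" "open (chart_image \<psi>)"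
      "homeomorphic_map (subtopology M (fst \<psi>)) (top_of_set (chart_image \<psi>)) (snd \<psi>)"
    and "openin T (fst \<kappa>)" and cont: "continuous_map M T id"
    using assms by (auto simp: submanifold_def smooth_manifold_def)
  from openin_continuous_map_preimage[OF cont \<open>openin T (fst \<kappa>)\<close>]
  have "openin M (fst \<psi> \<inter> {x \<in> topspace M. id x \<in> fst \<kappa>})"
    by (rule openin_Int[OF \<psi>(1)])
  moreover have "fst \<psi> \<inter> {x \<in> topspace M. id x \<in> fst \<kappa>} = fst \<psi> \<inter> fst \<kappa>"
    using openin_subset[OF \<psi>(1)] by auto
  ultimately have "openin (subtopology M (fst \<psi>)) (fst \<psi> \<inter> fst \<kappa>)"
    using openin_open_subtopology[OF \<psi>(1)] by simp
  then have "openin (top_of_set (chart_image \<psi>)) (snd \<psi> ` (fst \<psi> \<inter> fst \<kappa>))"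
    using homeomorphic_imp_open_map[OF \<psi>(3)] by (auto simp: open_map_def)
  then show ?thesis using \<psi>(2) openin_open_eq by blast
qed

lemma C_totally_real_patch_chart:
  assumes contact: "contact_metric_manifold T A \<phi> \<xi> \<eta> g" and sub: "submanifold M B T A"
    and real: "C_totally_real B A \<xi> g" and \<psi>: "\<psi> \<in> B" and \<kappa>: "\<kappa> \<in> A"
  shows "C_totally_real_patch (chart_image \<kappa>) (g \<kappa>) (\<phi> \<kappa>) (\<xi> \<kappa>) (\<eta> \<kappa>)
    (snd \<psi> ` (fst \<psi> \<inter> fst \<kappa>)) (transition \<psi> \<kappa>)"
proof -
  interpret contact_patch "chart_image \<kappa>" "g \<kappa>" "\<phi> \<kappa>" "\<xi> \<kappa>" "\<eta> \<kappa>"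
    by (rule contact_patch_chart[OF contact \<kappa>])
  have M: "smooth_manifold M B" using sub by (simp add: submanifold_def)
  have F: "transition \<psi> \<kappa> (snd \<psi> q) = snd \<kappa> q" if "q \<in> fst \<psi>" for q
    using chart_inv_apply[OF M \<psi> that] by (simp add: transition_def)
  show ?thesis
  proof
    show "open (snd \<psi> ` (fst \<psi> \<inter> fst \<kappa>))" by (rule open_chart_overlap[OF sub \<psi> \<kappa>])
    show "smooth_on (snd \<psi> ` (fst \<psi> \<inter> fst \<kappa>)) (transition \<psi> \<kappa>)"
      using sub \<psi> \<kappa> by (simp add: submanifold_def)
  next
    fix x assume "x \<in> snd \<psi> ` (fst \<psi> \<inter> fst \<kappa>)"
    then obtain q where q: "q \<in> fst \<psi> \<inter> fst \<kappa>" "x = snd \<psi> q" by blast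
    then show "transition \<psi> \<kappa> x \<in> chart_image \<kappa>" using F by auto
    show "inj (D (transition \<psi> \<kappa>) x)"
      using sub \<psi> \<kappa> q unfolding submanifold_def by blast
    fix u
    have "g \<kappa> (snd \<kappa> q) (\<xi> \<kappa> (snd \<kappa> q)) (D (transition \<psi> \<kappa>) (snd \<psi> q) u) = 0"
      using real \<psi> \<kappa> q(1) unfolding C_totally_real_def by blast
    then show "g \<kappa> (transition \<psi> \<kappa> x) (\<xi> \<kappa> (transition \<psi> \<kappa> x)) (push (transition \<psi> \<kappa>) x u) = 0"
      using F[of q] q by (simp add: push_def)
  qed
qed

theorem theorem4p1:
  fixes T M :: "'a topology"
    and A :: "('a, 'e::euclidean_space) chart set"
    and B :: "('a, 'd::euclidean_space) chart set"
    and \<phi> :: "('a, 'e) endo_field" and \<xi> :: "('a, 'e) vector_field"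
    and \<eta> :: "('a, 'e) one_form" and g :: "('a, 'e) bilinear_field"
    and f1 f2 f3 f4 f51 f52 f6 :: "'a \<Rightarrow> real"
    and n m :: nat
  assumes "gen_contact_space_form_divided_R5 T A \<phi> \<xi> \<eta> g f1 f2 f3 f4 f51 f52 f6"
    and "DIM('e) = 2 * m + 1"
    and "submanifold M B T A"
    and "DIM('d) = n" and "n \<ge> 3"
    and "C_totally_real B A \<xi> g"
    and "p \<in> topspace M"
    and "\<psi> \<in> B" and "p \<in> fst \<psi>"
    and "\<kappa> \<in> A" and "p \<in> fst \<kappa>"
  shows
    "let F = transition \<psi> \<kappa>; x = snd \<psi> p; G = g \<kappa>;
         ip = induced_metric G F x;
         H = mean_curvature G F x;
         hT = (\<lambda>U. tangential G F x (structure_h \<phi> \<xi> \<kappa> (F x) (push F x U)));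
         \<phi>hT = (\<lambda>U. tangential G F x
                  (\<phi> \<kappa> (F x) (structure_h \<phi> \<xi> \<kappa> (F x) (push F x U))));
         Ric = ricci (induced_metric G F) x;
         bound = (\<lambda>U. 1 / 4 * real n ^ 2 * G (F x) H H + (real n - 1) * f1 p
            + f4 p * (endo_trace hT + (real n - 2) * ip (hT U) U)
            + f51 p * (endo_trace hT * ip (hT U) U - ip (hT U) (hT U))
            + f52 p * (endo_trace \<phi>hT * ip (\<phi>hT U) U - ip (\<phi>hT U) (\<phi>hT U)))
     in (\<forall>U. ip U U = 1 \<longrightarrow> Ric U \<le> bound U)
      \<and> (H = 0 \<longrightarrow>
           (\<forall>U. ip U U = 1 \<longrightarrow> (Ric U = bound U \<longleftrightarrow> U \<in> relative_null_space G F x)))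
      \<and> ((\<forall>U. ip U U = 1 \<longrightarrow> Ric U = bound U) \<longleftrightarrow>
           totally_geodesic_at G F x \<or> (n = 2 \<and> totally_umbilical_at G F x))"
proof -
  define F where "F = transition \<psi> \<kappa>"
  define x where "x = snd \<psi> p"
  have form: "gen_space_form_divided_R5 T A \<phi> \<xi> \<eta> g f1 f2 f3 f4 f51 f52 f6"
    and contact: "contact_metric_manifold T A \<phi> \<xi> \<eta> g"
    using assms(1) by (simp_all add: gen_contact_space_form_divided_R5_def)
  interpret C_totally_real_patch "chart_image \<kappa>" "g \<kappa>" "\<phi> \<kappa>" "\<xi> \<kappa>" "\<eta> \<kappa>"
      "snd \<psi> ` (fst \<psi> \<inter> fst \<kappa>)" F
    unfolding F_def by (rule C_totally_real_patch_chart[OF contact assms(3,6,8,10)])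
  have x: "x \<in> snd \<psi> ` (fst \<psi> \<inter> fst \<kappa>)" using assms(9,11) by (simp add: x_def)
  have "smooth_manifold M B" using assms(3) by (simp add: submanifold_def)
  \<comment> \<open>The curvature hypothesis is stated at \<open>snd \<kappa> p\<close>, with the
    coefficient functions taken at p.\<close>
  then have Fx: "F x = snd \<kappa> p"
    using chart_inv_apply[OF _ assms(8,9)] by (simp add: F_def x_def transition_def)
  have curv: "curvature (g \<kappa>) (F x) X Y Z =
      f1 p *\<^sub>R R1 (g \<kappa> (F x)) X Y Z + f2 p *\<^sub>R R2 (g \<kappa> (F x)) (\<phi> \<kappa> (F x)) X Y Z
      + f3 p *\<^sub>R R3 (g \<kappa> (F x)) (\<xi> \<kappa> (F x)) (\<eta> \<kappa> (F x)) X Y Z + f4 p *\<^sub>R R4 (g \<kappa> (F x)) (h (F x)) X Y Z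
      + f51 p *\<^sub>R R51 (g \<kappa> (F x)) (h (F x)) X Y Z + f52 p *\<^sub>R R52 (g \<kappa> (F x)) (\<phi> \<kappa> (F x)) (h (F x)) X Y Z
      + f6 p *\<^sub>R R6 (g \<kappa> (F x)) (\<xi> \<kappa> (F x)) (\<eta> \<kappa> (F x)) (h (F x)) X Y Z" for X Y Z
    using form assms(10,11)
    unfolding gen_space_form_divided_R5_def Let_def Fx structure_h_def[abs_def] by blast
  define H where "H = mean_curvature (g \<kappa>) F x"
  interpret j: inner_form "\<gamma> x" by (rule I.inner[OF x])
  interpret i: inner_form "g \<kappa> (F x)" by (rule inner[OF F_in[OF x]])
  interpret N: normal_valued_form "\<gamma> x" "g \<kappa> (F x)" "\<sigma> x" H
    by standard (use \<sigma>_bilinear[OF x] \<sigma>_sym[OF x] mean_curvature[OF x] in \<open>simp_all add: H_def\<close>)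
  \<comment> \<open>The same choice as inside \<open>ricci\<close>, so that unfolding
    \<open>Ric U\<close> gives the sum along \<open>e U\<close>.\<close>
  define e where "e U = (SOME e. orthonormal_basis (\<gamma> x) e \<and> e 0 = U)" for U
  have e: "orthonormal_basis (\<gamma> x) (e U) \<and> e U 0 = U" if "\<gamma> x U U = 1" for U
  proof -
    have "\<exists>e. orthonormal_basis (\<gamma> x) e \<and> e 0 = U"
      by (rule j.ex_orthonormal_basis[OF that]) blast
    then show ?thesis unfolding e_def by (rule someI_ex)
  qed
  define Ric where "Ric = ricci \<gamma> x"
  define bound where "bound U = 1 / 4 * real n ^ 2 * g \<kappa> (F x) H H + (real n - 1) * f1 p
      + f4 p * (endo_trace (hT x) + (real n - 2) * \<gamma> x (hT x U) U)
      + f51 p * (endo_trace (hT x) * \<gamma> x (hT x U) U - \<gamma> x (hT x U) (hT x U))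
      + f52 p * (endo_trace (\<phi>hT x) * \<gamma> x (\<phi>hT x U) U - \<gamma> x (\<phi>hT x U) (\<phi>hT x U))" for U
  \<comment> \<open>All three claims are now claims about the sign and the vanishing of the
    bracketed defect.\<close>
  have Ric: "Ric U = bound U + (N.gauss_sum (e U) - 1 / 4 * real DIM('d) ^ 2 * g \<kappa> (F x) H H)"
    if U: "\<gamma> x U U = 1" for U
  proof -
    have "Ric U = (\<Sum>j=1..<DIM('d). sectional_curvature \<gamma> x (e U 0) (e U j))"
      by (simp add: Ric_def ricci_def Let_def e_def)
    also have "\<dots> = bound U - 1 / 4 * real n ^ 2 * g \<kappa> (F x) H H + N.gauss_sum (e U)"
      using sum_sectional_curvature[OF x curv, of "e U"] e[OF U] assms(4)
      by (simp add: bound_def N.gauss_sum_def)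
    finally show ?thesis using assms(4) by simp
  qed
  have "Ric U \<le> bound U" if "\<gamma> x U U = 1" for U
    using Ric[OF that] N.gauss_sum_le e[OF that] by simp
  moreover have "Ric U = bound U \<longleftrightarrow> U \<in> relative_null_space (g \<kappa>) F x" if "H = 0" "\<gamma> x U U = 1" for U
    using Ric[OF that(2)] N.equality_iff_relative_null[of "e U", OF _ that(1)] e[OF that(2)]
    by (simp add: relative_null_space_def)
  \<comment> \<open>As n >= 3 excludes n = 2, the right side amounts to the vanishing of \<sigma> at
    x.\<close>
  moreover have "(\<forall>U. \<gamma> x U U = 1 \<longrightarrow> Ric U = bound U) \<longleftrightarrow>
      totally_geodesic_at (g \<kappa>) F x \<or> (n = 2 \<and> totally_umbilical_at (g \<kappa>) F x)"
    using N.equality_everywhere_iff[of e] e assms(4,5) by (simp add: Ric totally_geodesic_at_def)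
  ultimately show ?thesis
    unfolding Let_def F_def[symmetric] x_def[symmetric] H_def[symmetric] structure_h_def
      hT_def[symmetric, abs_def] \<phi>hT_def[symmetric, abs_def] Ric_def[symmetric] bound_def[symmetric]
    by blast
qed

end
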